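(* Let $\hat{A},\hat{B}\in\mathbb{DC}_n^{\mathrm{CM}}$, let $r=\operatorname{Rank}(\hat A)$, and let $\hat A$ be of the form $$\hat{A}=\hat{U}\begin{bmatrix}\Sigma_1K&\Sigma_1L\\0&0\end{bmatrix}\hat{U}^*$$ with $\hat U\in\mathbb{DC}_n^U$, $K\in\mathbb{DC}^{r\times r}$, $L\in\mathbb{DC}^{r\times(n-r)}$, $KK^*+LL^*=I_r$, and $\Sigma_1=\operatorname{diag}(\mu_1,\ldots,\mu_r)$ with $\mu_1\ge\cdots\ge\mu_r$ positive appreciable dual numbers. Then $\hat{A}\overset{D-\mathrm{core}}{\leq}\hat{B}$ if and only if there exists $\hat{U}\in\mathbb{DC}_n^U$ such that $$\hat{A}=\hat{U}\begin{bmatrix}\Sigma_1K&\Sigma_1L\\0&0\end{bmatrix}\hat{U}^*\quad\text{and}\quad\hat{B}=\hat{U}\begin{bmatrix}\Sigma_1K&\Sigma_1L\\0&P\end{bmatrix}\hat{U}^*,$$ where $K\in\mathbb{DC}^{r\times r}$, $L\in\mathbb{DC}^{r\times(n-r)}$, $P\in\mathbb{DC}^{(n-r)\times(n-r)}$ satisfy $$KK^*+LL^*=I_r,\qquad\operatorname{Rank}(P^2)=\operatorname{Rank}(P),$$ and $\Sigma_1=\operatorname{diag}(\mu_1,\ldots,\mu_r)$ with $\mu_1\ge\cdots\ge\mu_r$ positive appreciable dual numbers.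
   Context: Dual complex numbers are $\hat a=a_s+\epsilon a_d$ with $a_s,a_d\in\mathbb{C}$, $\epsilon\ne0$, $\epsilon^2=0$, $\epsilon$ commuting with scalars; they form the ring $\mathbb{DC}$. A dual number is such an element with $a_s,a_d\in\mathbb{R}$. It is appreciable if $a_s\neq0$ and infinitesimal if $a_s=0$. Dual numbers are totally ordered by: $\hat a\le\hat b$ iff $a_s<b_s$, or $a_s=b_s$ and $a_d\le b_d$; $\hat a$ is positive if $\hat a>0$. A matrix $\hat A\in\mathbb{DC}^{m\times n}$ is written $\hat A=A_s+\epsilon A_d$ with $A_s,A_d\in\mathbb{C}^{m\times n}$; $\hat A^*=A_s^*+\epsilon A_d^*$. $\mathbb{DC}_n^U$ is the set of $\hat U\in\mathbb{DC}^{n\times n}$ with $\hat U^{-1}=\hat U^*$. Dual SVD: every $\hat A\in\mathbb{DC}^{m\times n}$ can be written $\hat A=\hat P_0\begin{bmatrix}\Sigma_0&0\\0&0\end{bmatrix}\hat V^*$ with $\hat P_0\in\mathbb{DC}_m^U$, $\hat V\in\mathbb{DC}_n^U$, $\Sigma_0=\operatorname{diag}(\mu_1,\ldots,\mu_t)$ with positive dual number entries in nonincreasing order (appreciable ones first, then infinitesimal ones), where $\Sigma_0$ is uniquely determined by $\hat A$; $\operatorname{Rank}(\hat A)=t$. $\mathbb{DC}_n^{\mathrm{CM}}=\{\hat A\in\mathbb{DC}^{n\times n}:\mathcal R(\hat A^2)=\mathcal R(\hat A)\}$, where $\mathcal R(\hat A)=\{\hat Ax:x\in\mathbb{DC}^n\}$;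 membership is also written $\operatorname{Ind}(\hat A)=1$. For $\hat A\in\mathbb{DC}_n^{\mathrm{CM}}$ the dual core generalized inverse $\hat A^{\mathrm{core}}$ is the unique $\hat X$ with $\hat A\hat X\hat A=\hat A$, $\hat A\hat X^2=\hat X$, $(\hat A\hat X)^*=\hat A\hat X$. D-core partial order: $\hat{A}\overset{D-\mathrm{core}}{\leq}\hat{B}$ means $\operatorname{Ind}(\hat A)=\operatorname{Ind}(\hat B)=1$, $\hat A^{\mathrm{core}}\hat A=\hat A^{\mathrm{core}}\hat B$ and $\hat A\hat A^{\mathrm{core}}=\hat B\hat A^{\mathrm{core}}$. *)

theory Defs
  imports "Jordan_Normal_Form.Matrix"
begin

section \<open>Dual complex numbers\<close>

text \<open>\<open>DC a b\<close> stands for $a + \epsilon b$ with $\epsilon \neq 0$ and $\epsilon^2 = 0$.\<close>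

datatype dual_complex = DC (std_part: complex) (dual_part: complex)

instantiation dual_complex :: comm_ring_1
begin

definition "0 = DC 0 0"
definition "1 = DC 1 0"
definition "x + y = DC (std_part x + std_part y) (dual_part x + dual_part y)"
definition "x - y = DC (std_part x - std_part y) (dual_part x - dual_part y)"
definition "- x = DC (- std_part x) (- dual_part x)"
definition "x * y = DC (std_part x * std_part y)
                       (std_part x * dual_part y + dual_part x * std_part y)"

instance
  by intro_classes
    (auto simp: zero_dual_complex_def one_dual_complex_def plus_dual_complex_def
      minus_dual_complex_def uminus_dual_complex_def times_dual_complex_def algebra_simps)

end

text \<open>The conjugation induced by $\hat A^* = A_s^* + \epsilon A_d^*$ on $1 \times 1$ matrices.\<close>

instantiation dual_complex :: conjugatable_ring
begin

definition "conjugate x = DC (cnj (std_part x)) (cnj (dual_part x))"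

instance
  by intro_classes
    (auto simp: conjugate_dual_complex_def zero_dual_complex_def plus_dual_complex_def
      uminus_dual_complex_def times_dual_complex_def intro: dual_complex.expand)

end

definition dual_eps :: dual_complex where
  "dual_eps = DC 0 1"

lemma dual_eps_nonzero: "dual_eps \<noteq> 0"
  by (simp add: dual_eps_def zero_dual_complex_def)

lemma dual_eps_square: "dual_eps * dual_eps = 0"
  by (simp add: dual_eps_def zero_dual_complex_def times_dual_complex_def)

lemma DC_decomp: "DC a b = DC a 0 + dual_eps * DC b 0"
  by (simp add: dual_eps_def plus_dual_complex_def times_dual_complex_def)

definition dual_number :: "dual_complex \<Rightarrow> bool" where
  "dual_number x \<longleftrightarrow> std_part x \<in> \<real> \<and> dual_part x \<in> \<real>"

definition appreciable :: "dual_complex \<Rightarrow> bool" where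
  "appreciable x \<longleftrightarrow> std_part x \<noteq> 0"

text \<open>The total order on dual numbers; it is only meaningful for arguments satisfying
  \<^const>\<open>dual_number\<close>, where \<^const>\<open>Re\<close> merely identifies real complex numbers with reals.\<close>

definition dual_le :: "dual_complex \<Rightarrow> dual_complex \<Rightarrow> bool" where
  "dual_le x y \<longleftrightarrow> Re (std_part x) < Re (std_part y) \<or>
     Re (std_part x) = Re (std_part y) \<and> Re (dual_part x) \<le> Re (dual_part y)"

definition dual_pos :: "dual_complex \<Rightarrow> bool" where
  "dual_pos x \<longleftrightarrow> dual_number x \<and> dual_le 0 x \<and> x \<noteq> 0"

section \<open>Dual complex matrices\<close>

text \<open>The library's \<open>mat_adjoint\<close> is restricted to fields.\<close>

definition adj :: "dual_complex mat \<Rightarrow> dual_complex mat" where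
  "adj A = map_mat conjugate (transpose_mat A)"

definition unitary_mats :: "nat \<Rightarrow> dual_complex mat set" where
  "unitary_mats n = {U \<in> carrier_mat n n. inverts_mat U (adj U) \<and> inverts_mat (adj U) U}"

text \<open>The diagonal is indexed from 0. In a nonincreasing sequence of positive dual numbers
  the appreciable entries automatically precede the infinitesimal ones.\<close>

definition dual_svd ::
  "dual_complex mat \<Rightarrow> nat \<Rightarrow> (nat \<Rightarrow> dual_complex) \<Rightarrow>
   dual_complex mat \<Rightarrow> dual_complex mat \<Rightarrow> bool" where
  "dual_svd A t \<mu> P V \<longleftrightarrow>
     (let m = dim_row A; n = dim_col A in
      t \<le> m \<and> t \<le> n \<and> P \<in> unitary_mats m \<and> V \<in> unitary_mats n \<and>
      (\<forall>i<t. dual_pos (\<mu> i)) \<and>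
      (\<forall>i j. i \<le> j \<longrightarrow> j < t \<longrightarrow> dual_le (\<mu> j) (\<mu> i)) \<and>
      A = P * four_block_mat (mat_diag t \<mu>) (0\<^sub>m t (n - t))
                             (0\<^sub>m (m - t) t) (0\<^sub>m (m - t) (n - t)) * adj V)"

text \<open>Every dual complex matrix has a dual singular value decomposition, and the number of
  its nonzero singular values (infinitesimal ones included) depends on the matrix only.\<close>

definition Rank :: "dual_complex mat \<Rightarrow> nat" where
  "Rank A = (THE t. \<exists>\<mu> P V. dual_svd A t \<mu> P V)"

definition range_mat :: "dual_complex mat \<Rightarrow> dual_complex vec set" where
  "range_mat A = {A *\<^sub>v x | x. x \<in> carrier_vec (dim_col A)}"

definition CM :: "nat \<Rightarrow> dual_complex mat set" where
  "CM n = {A \<in> carrier_mat n n. range_mat (A ^\<^sub>m 2) = range_mat A}"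

text \<open>For \<open>A\<close> in \<^term>\<open>CM n\<close> there is exactly one such \<open>X\<close>.\<close>

definition core_inverse :: "dual_complex mat \<Rightarrow> dual_complex mat" where
  "core_inverse A =
     (THE X. X \<in> carrier_mat (dim_row A) (dim_row A) \<and>
             A * X * A = A \<and> A * X ^\<^sub>m 2 = X \<and> adj (A * X) = A * X)"

definition d_core_le :: "dual_complex mat \<Rightarrow> dual_complex mat \<Rightarrow> bool" where
  "d_core_le A B \<longleftrightarrow>
     A \<in> CM (dim_row A) \<and> B \<in> CM (dim_row A) \<and>
     core_inverse A * A = core_inverse A * B \<and>
     A * core_inverse A = B * core_inverse A"

text \<open>$\mu_1 \ge \cdots \ge \mu_r$ are positive appreciable dual numbers.\<close>

definition appreciable_sing_vals :: "nat \<Rightarrow> (nat \<Rightarrow> dual_complex) \<Rightarrow> bool" where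
  "appreciable_sing_vals r \<mu> \<longleftrightarrow>
     (\<forall>i<r. dual_pos (\<mu> i) \<and> appreciable (\<mu> i)) \<and>
     (\<forall>i j. i \<le> j \<longrightarrow> j < r \<longrightarrow> dual_le (\<mu> j) (\<mu> i))"

end

theory Submission
  imports Defs "Jordan_Normal_Form.Spectral_Radius" "HOL-Library.Product_Lexorder"
begin

text \<open>Write \<open>T = \<Sigma>\<^sub>1 K\<close> and \<open>S = \<Sigma>\<^sub>1 L\<close>. Since \<open>K K\<^sup>* + L L\<^sup>* = I\<close> and \<open>\<Sigma>\<^sub>1\<close> is invertible, \<open>[T S]\<close> has a
  right inverse, so \<open>R(A\<^sup>2) = R(A)\<close> forces \<open>T\<close> to be invertible, and the core inverse of \<open>A\<close> is
  \<open>T\<^sup>-\<^sup>1\<close> in the upper left block. The order relation then says precisely that \<open>B\<close> agrees with \<open>A\<close>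
  in the first block row and has a zero block below \<open>T\<close>. For the remaining block \<open>P\<close>,
  \<open>R(B\<^sup>2) = R(B)\<close> gives \<open>R(P\<^sup>2) = R(P)\<close>, and the rank depends on the range only; here \<open>B\<close> being in
  \<open>CM\<close> is what makes the converse true, as the rank condition on \<open>P\<close> alone does not imply
  \<open>R(P\<^sup>2) = R(P)\<close> (take \<open>P\<close> with rows \<open>(0, 1)\<close> and \<open>(\<epsilon>, 0)\<close>).

  To speak about the rank one needs the dual singular value decomposition. It is obtained by
  splitting off one singular triple at a time, from an eigenvector of the dual Hermitian matrix
  \<open>A\<^sup>* A\<close>. The number of singular values is determined by the range: if \<open>R(A) \<subseteq> R(B)\<close>, the
  standard part of the transition matrix between the left singular vectors is unitary with a
  zero block, which a comparison of Frobenius norms only permits if \<open>A\<close> has at most as many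
  singular values as \<open>B\<close>.\<close>

section \<open>Unitary matrices over commutative rings with conjugation\<close>

lemma conjugate_one [simp]: "conjugate (1 :: 'a::{conjugatable_ring,comm_ring_1}) = 1"
proof -
  \<comment> \<open>Involutivity reduces the left side to \<open>1\<close> and the right side to
    \<open>conjugate 1\<close>.\<close>
  have "conjugate (1 * conjugate 1 :: 'a) = conjugate 1 * conjugate (conjugate 1)"
    by (rule conjugate_dist_mul)
  thus ?thesis by simp
qed

lemma conjugate_diff: "conjugate (a - b :: 'a::conjugatable_ring) = conjugate a - conjugate b"
  by (simp only: diff_conv_add_uminus conjugate_dist_add conjugate_neg)

text \<open>The same operation as \<open>adj\<close>, but over any commutative ring with
  conjugation, so that one development serves both complex and dual complex matrices.\<close>

definition ctr :: "'a::{conjugatable_ring,comm_ring_1} mat \<Rightarrow> 'a mat" where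
  "ctr A = map_mat conjugate (transpose_mat A)"

lemma ctr_carrier [simp]: "ctr A \<in> carrier_mat m n \<longleftrightarrow> A \<in> carrier_mat n m"
  by (simp add: ctr_def)

lemma dim_ctr [simp]: "dim_row (ctr A) = dim_col A" "dim_col (ctr A) = dim_row A"
  by (auto simp: ctr_def)

lemma index_ctr [simp]:
  "i < dim_col A \<Longrightarrow> j < dim_row A \<Longrightarrow> ctr A $$ (i, j) = conjugate (A $$ (j, i))"
  by (simp add: ctr_def)

lemma ctr_ctr [simp]: "ctr (ctr A) = A"
  by (rule eq_matI) auto

lemma ctr_one [simp]: "ctr (1\<^sub>m n) = 1\<^sub>m n"
  by (rule eq_matI) auto

lemma ctr_zero [simp]: "ctr (0\<^sub>m m n) = 0\<^sub>m n m"
  by (rule eq_matI) auto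

lemma ctr_smult: "ctr (c \<cdot>\<^sub>m A) = conjugate c \<cdot>\<^sub>m ctr A"
  by (rule eq_matI) (auto simp: conjugate_dist_mul)

lemma index_mult_mat_sum:
  "A \<in> carrier_mat m n \<Longrightarrow> B \<in> carrier_mat n k \<Longrightarrow> i < m \<Longrightarrow> j < k \<Longrightarrow>
    (A * B) $$ (i, j) = (\<Sum>l<n. A $$ (i, l) * B $$ (l, j))"
  by (auto simp: scalar_prod_def lessThan_atLeast0)

lemma ctr_mult:
  assumes "A \<in> carrier_mat m n" "B \<in> carrier_mat n k"
  shows "ctr (A * B) = ctr B * ctr A"
  using assms
  by (intro eq_matI)
     (auto simp: scalar_prod_def sum_conjugate conjugate_dist_mul mult.commute intro!: sum.cong)

lemma ctr_four_block:
  assumes "A \<in> carrier_mat a c" "B \<in> carrier_mat a d" "C \<in> carrier_mat b c" "D \<in> carrier_mat b d"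
  shows "ctr (four_block_mat A B C D) = four_block_mat (ctr A) (ctr C) (ctr B) (ctr D)"
  using assms by (intro eq_matI) auto

text \<open>Determinants replace dimension counting, which needs a field: \<open>det A\<close> is a
  unit with inverse \<open>det B\<close>, so the adjugate scaled by \<open>det B\<close> is a left
  inverse, and a left inverse coincides with a right one.\<close>

lemma right_inverse_imp_left_inverse:
  fixes A B :: "'a::comm_ring_1 mat"
  assumes A: "A \<in> carrier_mat n n" and B: "B \<in> carrier_mat n n" and AB: "A * B = 1\<^sub>m n"
  shows "B * A = 1\<^sub>m n"
proof -
  have "det A * det B = 1" using det_mult[OF A B] AB by simp
  define C where "C = det B \<cdot>\<^sub>m adj_mat A"
  have C: "C \<in> carrier_mat n n" using adj_mat(1)[OF A] by (simp add: C_def)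
  have "C * A = det B \<cdot>\<^sub>m (det A \<cdot>\<^sub>m 1\<^sub>m n)"
    using adj_mat[OF A] A by (simp add: C_def mult_smult_assoc_mat[of _ n n _ n])
  also have "\<dots> = 1\<^sub>m n"
    using \<open>det A * det B = 1\<close> by (intro eq_matI) (auto simp: mult.commute)
  finally have CA: "C * A = 1\<^sub>m n" .
  have "C = C * (A * B)" using C AB by simp
  also have "\<dots> = C * A * B" using A B C by (simp add: assoc_mult_mat[of _ n n _ n])
  also have "\<dots> = B" using CA B by simp
  finally show ?thesis using CA by simp
qed

definition unitary :: "nat \<Rightarrow> 'a::{conjugatable_ring,comm_ring_1} mat \<Rightarrow> bool" where
  "unitary n U \<longleftrightarrow> U \<in> carrier_mat n n \<and> ctr U * U = 1\<^sub>m n \<and> U * ctr U = 1\<^sub>m n"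

lemma unitaryI: "U \<in> carrier_mat n n \<Longrightarrow> ctr U * U = 1\<^sub>m n \<Longrightarrow> unitary n U"
  unfolding unitary_def using right_inverse_imp_left_inverse[of "ctr U" n U] by auto

lemma unitaryD:
  assumes "unitary n U"
  shows "U \<in> carrier_mat n n" "ctr U * U = 1\<^sub>m n" "U * ctr U = 1\<^sub>m n"
  using assms by (auto simp: unitary_def)

lemma unitary_one [simp]: "unitary n (1\<^sub>m n)"
  by (simp add: unitary_def)

lemma unitary_ctr: "unitary n U \<Longrightarrow> unitary n (ctr U)"
  by (auto simp: unitary_def)

lemma unitary_cancel:
  assumes "unitary n U" "A \<in> carrier_mat n k"
  shows "ctr U * (U * A) = A" "U * (ctr U * A) = A"
  using assms unitaryD[OF assms(1)]
  by (auto simp: assoc_mult_mat[of _ n n _ n _ k, symmetric])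

lemma unitary_cancel_right:
  assumes "unitary n U" "A \<in> carrier_mat k n"
  shows "A * U * ctr U = A" "A * ctr U * U = A"
  using assms unitaryD[OF assms(1)]
  by (auto simp: assoc_mult_mat[of _ k n _ n _ n])

lemma unitary_mult:
  assumes U: "unitary n U" and V: "unitary n V"
  shows "unitary n (U * V)"
proof (rule unitaryI)
  note u = unitaryD[OF U] and v = unitaryD[OF V]
  show "U * V \<in> carrier_mat n n" using u v by auto
  have "ctr (U * V) * (U * V) = ctr V * (ctr U * (U * V))"
    using u v by (simp add: ctr_mult[of _ n n _ n] assoc_mult_mat[of _ n n _ n _ n])
  thus "ctr (U * V) * (U * V) = 1\<^sub>m n" using unitary_cancel(1)[OF U v(1)] v by simp
qed

section \<open>Completing a unit vector to a unitary matrix\<close>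

text \<open>Vectors are kept as one-column matrices, so that associativity and \<open>ctr\<close>
  apply to them directly.\<close>

definition unit_col :: "nat \<Rightarrow> nat \<Rightarrow> 'a::comm_ring_1 mat" where
  "unit_col n p = mat n 1 (\<lambda>(i, j). if i = p then 1 else 0)"

lemma unit_col_carrier [simp]: "unit_col n p \<in> carrier_mat n 1" "unit_col n p \<in> carrier_mat n (Suc 0)"
  by (simp_all add: unit_col_def)

text \<open>A reflection-like map: for unit vectors \<open>e\<close>, \<open>v\<close> and \<open>w = e - v\<close>, the matrix
  \<open>I - w w\<^sup>* / (w\<^sup>* e)\<close> is unitary and sends \<open>e\<close> to \<open>v\<close>. Unlike a Householder reflection it needs no
  square root or phase, only that \<open>w\<^sup>* e\<close> is a unit.\<close>

lemma unitary_completion_aux: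
  fixes v :: "'a::{conjugatable_ring,comm_ring_1} mat"
  assumes v: "v \<in> carrier_mat n 1" and unit: "ctr v * v = 1\<^sub>m 1" and n: "n > 0"
    and d: "(1 - v $$ (0, 0)) * d = 1"
  shows "\<exists>U. unitary n U \<and> U * unit_col n 0 = v"
proof -
  \<comment> \<open>The denominator \<open>w\<^sup>* e\<close> is the conjugate of
    \<open>1 - v $$ (0, 0)\<close>, so its inverse is the conjugate of \<open>d\<close>.\<close>
  define c :: 'a where "c = conjugate d"
  define w where "w i = (if i = 0 then 1 else 0) - v $$ (i, 0)" for i
  define \<delta> :: "nat \<Rightarrow> nat \<Rightarrow> 'a" where "\<delta> i j = (if i = j then 1 else 0)" for i j
  have c: "(1 - conjugate (v $$ (0, 0))) * c = 1"
    unfolding c_def using arg_cong[OF d, of conjugate]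
    by (simp add: conjugate_dist_mul conjugate_diff)
  define U where "U = mat n n (\<lambda>(i, j). \<delta> i j - w i * conjugate (w j) * c)"
  have "(\<Sum>k<n. conjugate (v $$ (k, 0)) * v $$ (k, 0)) = (ctr v * v) $$ (0, 0)"
    using v by (subst index_mult_mat_sum[of _ 1 n _ 1]) auto
  hence vv: "(\<Sum>k<n. conjugate (v $$ (k, 0)) * v $$ (k, 0)) = 1" using unit by simp
  have "(\<Sum>k<n. conjugate (w k) * w k)
      = (\<Sum>k<n. \<delta> 0 k - \<delta> 0 k * v $$ (k, 0) - \<delta> 0 k * conjugate (v $$ (k, 0))
            + conjugate (v $$ (k, 0)) * v $$ (k, 0))"
    by (rule sum.cong) (auto simp: w_def \<delta>_def conjugate_diff algebra_simps)
  also have "\<dots> = (1 - v $$ (0, 0)) + (1 - conjugate (v $$ (0, 0)))"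
    using n by (simp add: sum.distrib sum_subtractf vv \<delta>_def if_distrib[of "\<lambda>x. x * _"] cong: if_cong)
  finally have ws: "(\<Sum>k<n. conjugate (w k) * w k)
      = (1 - v $$ (0, 0)) + (1 - conjugate (v $$ (0, 0)))" .
  \<comment> \<open>The squared length of \<open>w\<close> is the sum of the two elements inverted
    by \<open>d\<close> and \<open>c\<close>. Multiplied by \<open>c * d\<close> it collapses to
    \<open>c + d\<close>, which is what cancels the mixed terms of \<open>ctr U * U\<close>.\<close>
  have ww: "(\<Sum>k<n. conjugate (w k) * w k) * (c * d) = c + d"
  proof -
    have "((1 - v $$ (0, 0)) + (1 - conjugate (v $$ (0, 0)))) * (c * d)
        = ((1 - v $$ (0, 0)) * d) * c + ((1 - conjugate (v $$ (0, 0))) * c) * d"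
      by (simp add: algebra_simps)
    thus ?thesis using ws c d by simp
  qed
  have U: "U \<in> carrier_mat n n" by (simp add: U_def)
  have "ctr U * U = 1\<^sub>m n"
  proof (rule eq_matI)
    fix i j assume ij: "i < dim_row (1\<^sub>m n :: 'a mat)" "j < dim_col (1\<^sub>m n :: 'a mat)"
    hence "(ctr U * U) $$ (i, j) = (\<Sum>k<n. conjugate (U $$ (k, i)) * U $$ (k, j))"
      using U by (subst index_mult_mat_sum[of _ n n _ n]) auto
    also have "\<dots> = (\<Sum>k<n. \<delta> k i * \<delta> k j - \<delta> k i * w k * (conjugate (w j) * c)
        - \<delta> k j * conjugate (w k) * (w i * d)
        + conjugate (w k) * w k * (w i * conjugate (w j) * (c * d)))"
      using ij by (intro sum.cong)
        (auto simp: U_def c_def conjugate_diff conjugate_dist_mul algebra_simps \<delta>_def)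
    also have "\<dots> = \<delta> i j - w i * (conjugate (w j) * c) - conjugate (w j) * (w i * d)
        + (\<Sum>k<n. conjugate (w k) * w k) * (w i * conjugate (w j) * (c * d))"
      using ij by (simp add: sum.distrib sum_subtractf \<delta>_def sum_distrib_right
        if_distrib[of "\<lambda>x. x * _"] cong: if_cong)
    also have "(\<Sum>k<n. conjugate (w k) * w k) * (w i * conjugate (w j) * (c * d))
        = w i * conjugate (w j) * (c + d)"
      unfolding ww[symmetric] by (simp add: algebra_simps)
    finally show "(ctr U * U) $$ (i, j) = 1\<^sub>m n $$ (i, j)"
      using ij by (simp add: algebra_simps \<delta>_def)
  qed (use U in auto)
  moreover have "U * unit_col n 0 = v"
  proof (rule eq_matI)
    fix i j assume ij: "i < dim_row v" "j < dim_col v"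
    hence "(U * unit_col n 0) $$ (i, j) = (\<Sum>k<n. U $$ (i, k) * unit_col n 0 $$ (k, j))"
      using U v by (subst index_mult_mat_sum[of _ n n _ 1]) auto
    also have "\<dots> = (\<Sum>k<n. if k = 0 then U $$ (i, k) else 0)"
      using ij v by (intro sum.cong) (auto simp: unit_col_def)
    also have "\<dots> = U $$ (i, 0)" using n by simp
    also have "\<dots> = \<delta> i 0 - w i * ((1 - conjugate (v $$ (0, 0))) * c)"
      using ij n v by (simp add: U_def w_def conjugate_diff algebra_simps)
    also have "\<dots> = v $$ (i, j)" using ij v by (simp add: c) (simp add: w_def \<delta>_def)
    finally show "(U * unit_col n 0) $$ (i, j) = v $$ (i, j)" .
  qed (use U v in \<open>auto simp: unit_col_def\<close>)
  ultimately show ?thesis using unitaryI[OF U] by blast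
qed

lemma gram_uminus: "ctr (- A) * (- A) = ctr A * A"
  by (intro eq_matI) (auto simp: scalar_prod_def conjugate_neg sum_negf)

text \<open>If only \<open>1 + v $$ (0, 0)\<close> is a unit, \<open>- v\<close> is completed
  instead and the unitary matrix negated. In the local rings used below one of the two elements is
  always a unit, as they add up to the unit \<open>2\<close>.\<close>

lemma unitary_completion:
  fixes v :: "'a::{conjugatable_ring,comm_ring_1} mat"
  assumes v: "v \<in> carrier_mat n 1" and unit: "ctr v * v = 1\<^sub>m 1" and n: "n > 0"
    and d: "1 - v $$ (0, 0) dvd 1 \<or> 1 + v $$ (0, 0) dvd 1"
  shows "\<exists>U. unitary n U \<and> U * unit_col n 0 = v"
  using d
proof
  assume "1 - v $$ (0, 0) dvd 1"
  thus ?thesis using unitary_completion_aux[OF v unit n] by (metis dvdE)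
next
  assume "1 + v $$ (0, 0) dvd 1"
  then obtain k where a: "(1 + v $$ (0, 0)) * k = 1" by (metis dvdE)
  have "(- v) $$ (0, 0) = - (v $$ (0, 0))" using v n by auto
  then obtain U where U: "unitary n U" "U * unit_col n 0 = - v"
    using unitary_completion_aux[of "- v" n] v unit n a by (auto simp: gram_uminus)
  have "unitary n (- U)" using unitaryD[OF U(1)] by (intro unitaryI) (auto simp: gram_uminus)
  moreover have "(- U) * unit_col n 0 = v"
    using unitaryD(1)[OF U(1)] U(2) v by (subst uminus_mult_left_mat) (auto simp: unit_col_def)
  ultimately show ?thesis by blast
qed

section \<open>Splitting off a singular triple\<close>

text \<open>The middle factor of a singular value decomposition, given entrywise to avoid block
  dimensions; \<open>four_block_rect_diag\<close> links it to \<open>dual_svd\<close>.\<close>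

definition rect_diag :: "nat \<Rightarrow> nat \<Rightarrow> nat \<Rightarrow> (nat \<Rightarrow> 'a) \<Rightarrow> 'a::comm_ring_1 mat" where
  "rect_diag m n t \<mu> = mat m n (\<lambda>(i, j). if i = j \<and> i < t then \<mu> i else 0)"

lemma rect_diag_carrier [simp]: "rect_diag m n t \<mu> \<in> carrier_mat m n"
  by (simp add: rect_diag_def)

text \<open>The shape that a matrix takes once one singular triple has been split off.\<close>

definition bordered :: "'a::{conjugatable_ring,comm_ring_1} \<Rightarrow> 'a mat \<Rightarrow> 'a mat" where
  "bordered s A = four_block_mat (s \<cdot>\<^sub>m 1\<^sub>m 1) (0\<^sub>m 1 (dim_col A)) (0\<^sub>m (dim_row A) 1) A"

lemma bordered_carrier [simp]: "A \<in> carrier_mat m n \<Longrightarrow> bordered s A \<in> carrier_mat (Suc m) (Suc n)"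
  unfolding bordered_def using four_block_carrier_mat[of "s \<cdot>\<^sub>m 1\<^sub>m 1" 1 1 A m n] by simp

lemma bordered_mult:
  assumes "A \<in> carrier_mat m n" "B \<in> carrier_mat n k"
  shows "bordered s A * bordered t B = bordered (s * t) (A * B)"
  unfolding bordered_def using assms
  by (subst mult_four_block_mat[of _ 1 1 _ n _ m _ _ 1 _ k]) (auto intro!: cong_four_block_mat)

lemma ctr_bordered: "ctr (bordered s A) = bordered (conjugate s) (ctr A)"
  unfolding bordered_def by (subst ctr_four_block[of _ 1 1 _ "dim_col A" _ "dim_row A"])
    (auto simp: ctr_smult)

lemma bordered_one: "bordered 1 (1\<^sub>m n) = 1\<^sub>m (Suc n)"
  unfolding bordered_def by (rule eq_matI) auto

lemma unitary_bordered: "unitary n P \<Longrightarrow> unitary (Suc n) (bordered 1 P)"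
  by (auto simp: unitary_def ctr_bordered bordered_mult[of _ n n _ n] bordered_one)

lemma bordered_rect_diag:
  "bordered s (rect_diag m n t \<mu>) = rect_diag (Suc m) (Suc n) (Suc t) (case_nat s \<mu>)"
  by (rule eq_matI) (auto simp: bordered_def rect_diag_def split: nat.split)

text \<open>In the new bases the equation for \<open>A * v\<close> fixes the first column and the
  one for \<open>ctr A * u\<close> the first row, up to conjugation. Both vanish beyond the corner,
  and \<open>conjugate s = s\<close> makes them agree there.\<close>

lemma deflation:
  fixes A :: "'a::{conjugatable_ring,comm_ring_1} mat"
  assumes A: "A \<in> carrier_mat (Suc m) (Suc n)"
    and U: "unitary (Suc m) U" "U * unit_col (Suc m) 0 = u"
    and V: "unitary (Suc n) V" "V * unit_col (Suc n) 0 = v"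
    and Av: "A * v = s \<cdot>\<^sub>m u" and Au: "ctr A * u = s \<cdot>\<^sub>m v" and s: "conjugate s = s"
  shows "\<exists>A' \<in> carrier_mat m n. ctr U * A * V = bordered s A'"
proof -
  note uc = unitaryD(1)[OF U(1)] and vc = unitaryD(1)[OF V(1)]
  define F where "F = ctr U * A * V"
  have F: "F \<in> carrier_mat (Suc m) (Suc n)" using A uc vc by (auto simp: F_def)
  have col0: "F * unit_col (Suc n) 0 = s \<cdot>\<^sub>m unit_col (Suc m) 0"
  proof -
    have "F * unit_col (Suc n) 0 = ctr U * (A * v)"
      using A uc vc V(2) unfolding F_def
      by (simp add: assoc_mult_mat[of _ _ "Suc n" _ "Suc n" _ 1]
        assoc_mult_mat[of _ "Suc m" "Suc m" _ "Suc n" _ 1])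
    also have "\<dots> = s \<cdot>\<^sub>m (ctr U * u)" using uc U(2) unfolding Av
      by (auto intro!: mult_smult_distrib[of _ _ "Suc m" _ 1])
    also have "ctr U * u = unit_col (Suc m) 0" using unitary_cancel(1)[OF U(1), of "unit_col (Suc m) 0" 1] U(2) by simp
    finally show ?thesis .
  qed
  have row0: "ctr F * unit_col (Suc m) 0 = s \<cdot>\<^sub>m unit_col (Suc n) 0"
  proof -
    have "ctr F = ctr V * (ctr A * U)"
      using A uc vc unfolding F_def
      by (simp add: ctr_mult[of _ "Suc m" "Suc n"] ctr_mult[of _ "Suc m" "Suc m" _ "Suc n"])
    hence "ctr F * unit_col (Suc m) 0 = ctr V * (ctr A * u)"
      using A uc vc U(2)
      by (simp add: assoc_mult_mat[of _ "Suc n" "Suc n" _ "Suc m" _ 1]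
        assoc_mult_mat[of _ "Suc n" "Suc m" _ "Suc m" _ 1])
    also have "\<dots> = s \<cdot>\<^sub>m (ctr V * v)" using vc V(2) unfolding Au
      by (auto intro!: mult_smult_distrib[of _ _ "Suc n" _ 1])
    also have "ctr V * v = unit_col (Suc n) 0" using unitary_cancel(1)[OF V(1), of "unit_col (Suc n) 0" 1] V(2) by simp
    finally show ?thesis .
  qed
  have e1: "(G * unit_col k 0) $$ (i, 0) = G $$ (i, 0)"
    if "G \<in> carrier_mat l k" "i < l" "k > 0" for G :: "'a mat" and i k l
    using that by (subst index_mult_mat_sum[of _ l k _ 1])
      (auto simp: unit_col_def if_distrib[of "\<lambda>x. _ * x"] cong: if_cong)
  have c: "F $$ (i, 0) = (if i = 0 then s else 0)" if "i < Suc m" for i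
    using arg_cong[OF col0, of "\<lambda>M. M $$ (i, 0)"] e1[OF F that] that by (auto simp: unit_col_def)
  have r: "F $$ (0, j) = (if j = 0 then s else 0)" if "j < Suc n" for j
  proof -
    have "ctr F \<in> carrier_mat (Suc n) (Suc m)" using F by simp
    hence "conjugate (F $$ (0, j)) = (s \<cdot>\<^sub>m unit_col (Suc n) 0) $$ (j, 0)"
      using e1[of "ctr F" "Suc n" "Suc m" j] F that row0 by auto
    hence "conjugate (F $$ (0, j)) = (if j = 0 then s else 0)" using that by (auto simp: unit_col_def)
    thus ?thesis using s by (metis conjugate_id conjugate_zero)
  qed
  have "F = bordered s (mat m n (\<lambda>(i, j). F $$ (Suc i, Suc j)))"
    using F c r by (intro eq_matI) (auto simp: bordered_def)
  thus ?thesis unfolding F_def[symmetric] by (intro bexI) auto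
qed

text \<open>The induction step shared by the spectral theorem, where both unitary factors agree, and
  the singular value decomposition. Multiplicativity of \<open>bordered\<close> moves the border
  into the three factors.\<close>

lemma deflation_compose:
  fixes A :: "'a::{conjugatable_ring,comm_ring_1} mat"
  assumes A: "A \<in> carrier_mat (Suc m) (Suc n)" and U: "unitary (Suc m) U" and V: "unitary (Suc n) V"
    and F: "ctr U * A * V = bordered s A'"
    and P: "unitary m P" and Q: "unitary n Q" and A': "A' = P * rect_diag m n t \<mu> * ctr Q"
  shows "A = (U * bordered 1 P) * rect_diag (Suc m) (Suc n) (Suc t) (case_nat s \<mu>)
             * ctr (V * bordered 1 Q)"
proof -
  note uc = unitaryD(1)[OF U(1)] and vc = unitaryD(1)[OF V(1)]
  note pc = unitaryD(1)[OF P(1)] and qc = unitaryD(1)[OF Q(1)]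
  let ?D = "rect_diag (Suc m) (Suc n) (Suc t) (case_nat s \<mu>)"
  have "A = U * (ctr U * A * V) * ctr V"
    using A uc vc unitary_cancel(2)[OF U, of "A * V" "Suc n"] unitary_cancel_right(1)[OF V A]
    by (simp add: assoc_mult_mat[of _ "Suc m" "Suc m" _ "Suc n" _ "Suc n"])
  also have "ctr U * A * V = bordered 1 P * ?D * ctr (bordered 1 Q)"
    unfolding F A' bordered_rect_diag[symmetric] ctr_bordered
    using pc qc by (simp add: bordered_mult[of _ m m _ n] bordered_mult[of _ m n _ n])
  also have "U * \<dots> * ctr V = (U * bordered 1 P) * ?D * ctr (V * bordered 1 Q)"
  proof -
    have b: "bordered 1 P \<in> carrier_mat (Suc m) (Suc m)" "bordered 1 Q \<in> carrier_mat (Suc n) (Suc n)"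
      using pc qc by auto
    have "bordered 1 P * (?D * ctr (bordered 1 Q)) \<in> carrier_mat (Suc m) (Suc n)"
      "?D * ctr (bordered 1 Q) \<in> carrier_mat (Suc m) (Suc n)"
      using b by (meson ctr_carrier mult_carrier_mat rect_diag_carrier)+
    thus ?thesis using uc vc b
      by (simp add: ctr_mult[of _ "Suc n" "Suc n" _ "Suc n"]
         assoc_mult_mat[of _ "Suc m" "Suc m" _ "Suc m" _ "Suc n"]
         assoc_mult_mat[of _ "Suc m" "Suc m" _ "Suc n" _ "Suc n"]
         assoc_mult_mat[of _ "Suc m" "Suc n" _ "Suc n" _ "Suc n"])
  qed
  finally show ?thesis .
qed

text \<open>The entry of \<open>ctr v * (A * v)\<close> is \<open>s\<close> because \<open>v\<close>
  is a unit vector, and it is self-conjugate because \<open>A\<close> is. Over the dual complex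
  numbers this makes \<open>s\<close> a dual number.\<close>

lemma hermitian_eigenvalue_real:
  fixes A :: "'a::{conjugatable_ring,comm_ring_1} mat"
  assumes A: "A \<in> carrier_mat n n" and h: "ctr A = A" and v: "v \<in> carrier_mat n 1"
    and unit: "ctr v * v = 1\<^sub>m 1" and ev: "A * v = s \<cdot>\<^sub>m v"
  shows "conjugate s = s"
proof -
  have 1: "ctr v * (A * v) = s \<cdot>\<^sub>m 1\<^sub>m 1"
    unfolding ev using v by (simp add: mult_smult_distrib[of _ 1 n _ 1] unit)
  have "ctr (ctr v * (A * v)) = ctr v * (A * v)"
    using A v h by (simp add: ctr_mult[of _ 1 n _ 1] ctr_mult[of _ n n _ 1]
      assoc_mult_mat[of _ 1 n _ n _ 1])
  from arg_cong[OF this, of "\<lambda>M. M $$ (0, 0)"] show ?thesis by (simp add: 1)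
qed

section \<open>The spectral theorem for complex Hermitian matrices\<close>

lemma complex_unit_eigenvector:
  fixes A :: "complex mat"
  assumes A: "A \<in> carrier_mat n n" and n: "n > 0"
  shows "\<exists>v s. v \<in> carrier_mat n 1 \<and> ctr v * v = 1\<^sub>m 1 \<and> A * v = s \<cdot>\<^sub>m v"
proof -
  from spectrum_non_empty[OF A n] obtain s x where ev: "eigenvector A x s"
    by (auto simp: spectrum_def eigenvalue_def)
  hence x: "x \<in> carrier_vec n" "x \<noteq> 0\<^sub>v n" "A *\<^sub>v x = s \<cdot>\<^sub>v x"
    using A by (auto simp: eigenvector_def)
  define N where "N = (\<Sum>k<n. (cmod (x $ k))\<^sup>2)"
  from x(1,2) obtain k where "k < n" "x $ k \<noteq> 0" by (metis carrier_vecD eq_vecI index_zero_vec)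
  hence "0 < (cmod (x $ k))\<^sup>2" "(cmod (x $ k))\<^sup>2 \<le> N"
    by (auto simp: N_def intro!: member_le_sum)
  hence N: "N > 0" by linarith
  define v where "v = mat n 1 (\<lambda>(i, j). x $ i / complex_of_real (sqrt N))"
  have v: "v \<in> carrier_mat n 1" by (simp add: v_def)
  have "(ctr v * v) $$ (0, 0) = (\<Sum>k<n. cnj (x $ k) * x $ k / complex_of_real N)"
    using N by (subst index_mult_mat_sum[of _ 1 n _ 1])
      (auto simp: v_def intro!: sum.cong simp flip: of_real_mult)
  also have "\<dots> = (\<Sum>k<n. complex_of_real ((cmod (x $ k))\<^sup>2)) / complex_of_real N"
    unfolding sum_divide_distrib
    by (intro sum.cong refl) (metis complex_norm_square mult.commute of_real_power)
  also have "\<dots> = complex_of_real N / complex_of_real N" by (simp add: N_def)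
  also have "\<dots> = 1" using N by simp
  finally have "ctr v * v = 1\<^sub>m 1" using v by (intro eq_matI) auto
  moreover have "A * v = s \<cdot>\<^sub>m v"
  proof (rule eq_matI)
    fix i j assume ij: "i < dim_row (s \<cdot>\<^sub>m v)" "j < dim_col (s \<cdot>\<^sub>m v)"
    hence "(A * v) $$ (i, j) = (\<Sum>k<n. A $$ (i, k) * x $ k) / complex_of_real (sqrt N)"
      using A v by (subst index_mult_mat_sum[of _ n n _ 1])
        (auto simp: v_def sum_divide_distrib intro!: sum.cong)
    also have "(\<Sum>k<n. A $$ (i, k) * x $ k) = (A *\<^sub>v x) $ i"
      using A x(1) ij v by (auto simp: scalar_prod_def lessThan_atLeast0)
    finally show "(A * v) $$ (i, j) = (s \<cdot>\<^sub>m v) $$ (i, j)"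
      using x(1,3) ij v by (auto simp: v_def)
  qed (use A v in auto)
  ultimately show ?thesis using v by blast
qed

lemma bordered_inject: "bordered s A = bordered s B \<Longrightarrow> A = B"
proof (rule eq_matI)
  assume eq: "bordered s A = bordered s B"
  have "Suc (dim_row A) = Suc (dim_row B)" "Suc (dim_col A) = Suc (dim_col B)"
    using arg_cong[OF eq, of dim_row] arg_cong[OF eq, of dim_col] by (auto simp: bordered_def)
  thus d: "dim_row A = dim_row B" "dim_col A = dim_col B" by auto
  show "A $$ (i, j) = B $$ (i, j)" if "i < dim_row B" "j < dim_col B" for i j
    using arg_cong[OF eq, of "\<lambda>M. M $$ (Suc i, Suc j)"] that d by (auto simp: bordered_def)
qed

text \<open>Induction on the dimension: a unit eigenvector is completed to a unitary matrix and
  split off by \<open>deflation\<close> with \<open>u = v\<close>. The remaining block is Hermitian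
  because \<open>bordered\<close> is injective.\<close>

theorem complex_spectral_theorem:
  fixes A :: "complex mat"
  assumes "A \<in> carrier_mat n n" "ctr A = A"
  shows "\<exists>U d. unitary n U \<and> A = U * rect_diag n n n d * ctr U \<and> (\<forall>i<n. cnj (d i) = d i)"
  using assms
proof (induction n arbitrary: A)
  case 0
  thus ?case by (intro exI[of _ "1\<^sub>m 0"] exI[of _ "\<lambda>_. 0"]) auto
next
  case (Suc n)
  note A = Suc.prems
  obtain v s where v: "v \<in> carrier_mat (Suc n) 1" "ctr v * v = 1\<^sub>m 1" "A * v = s \<cdot>\<^sub>m v"
    using complex_unit_eigenvector[OF A(1)] by auto
  have s: "conjugate s = s" by (rule hermitian_eigenvalue_real[OF A v])
  have "1 - v $$ (0, 0) \<noteq> 0 \<or> 1 + v $$ (0, 0) \<noteq> 0" by (auto simp: eq_neg_iff_add_eq_0)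
  then obtain U where U: "unitary (Suc n) U" "U * unit_col (Suc n) 0 = v"
    using unitary_completion[OF v(1,2)] by (auto simp: dvd_field_iff)
  obtain A' where A': "A' \<in> carrier_mat n n" and F: "ctr U * A * U = bordered s A'"
    using deflation[OF A(1) U U v(3) _ s] A(2) v(3) by auto
  have "ctr (ctr U * A * U) = ctr U * A * U"
    using A unitaryD(1)[OF U(1)]
    by (simp add: ctr_mult[of _ "Suc n" "Suc n" _ "Suc n"]
      assoc_mult_mat[of _ "Suc n" "Suc n" _ "Suc n" _ "Suc n"])
  hence "bordered s (ctr A') = bordered s A'" unfolding F ctr_bordered s .
  hence "ctr A' = A'" by (rule bordered_inject)
  from Suc.IH[OF A' this] obtain P d where P: "unitary n P" "A' = P * rect_diag n n n d * ctr P"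
    and d: "\<forall>i<n. cnj (d i) = d i" by blast
  show ?case
    using deflation_compose[OF A(1) U(1) U(1) F P(1) P(1) P(2)]
      unitary_mult[OF U(1) unitary_bordered[OF P(1)]] d s
    by (intro exI[of _ "U * bordered 1 P"] exI[of _ "case_nat s d"])
       (auto split: nat.split simp: less_Suc_eq_0_disj)
qed

text \<open>After diagonalization some diagonal entry is nonzero, as otherwise \<open>A\<close>
  would vanish; the corresponding column of \<open>U\<close> is the eigenvector.\<close>

lemma complex_hermitian_nonzero_eigenvalue:
  fixes A :: "complex mat"
  assumes A: "A \<in> carrier_mat n n" "ctr A = A" and nz: "A \<noteq> 0\<^sub>m n n"
  shows "\<exists>v s. v \<in> carrier_mat n 1 \<and> ctr v * v = 1\<^sub>m 1 \<and> A * v = s \<cdot>\<^sub>m v \<and> s \<noteq> 0"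
proof -
  obtain U d where U: "unitary n U" and AU: "A = U * rect_diag n n n d * ctr U"
    using complex_spectral_theorem[OF A] by blast
  note uc = unitaryD(1)[OF U]
  have "\<exists>p<n. d p \<noteq> 0"
  proof (rule ccontr)
    assume "\<not> ?thesis"
    hence "rect_diag n n n d = 0\<^sub>m n n" by (intro eq_matI) (auto simp: rect_diag_def)
    thus False using AU nz uc by auto
  qed
  then obtain p where p: "p < n" "d p \<noteq> 0" by blast
  define v where "v = U * unit_col n p"
  have v: "v \<in> carrier_mat n 1" using uc by (auto simp: v_def)
  have Uv: "ctr U * v = unit_col n p" unfolding v_def by (rule unitary_cancel(1)[OF U unit_col_carrier(1)])
  have "ctr v * v = ctr (unit_col n p) * (ctr U * v)"
    using uc v by (simp add: v_def ctr_mult[of _ n n _ 1] assoc_mult_mat[of _ 1 n _ n _ 1])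
  also have "\<dots> = 1\<^sub>m 1" unfolding Uv using p
    by (intro eq_matI) (auto simp: unit_col_def scalar_prod_def if_distrib cong: if_cong)
  finally have "ctr v * v = 1\<^sub>m 1" .
  moreover have "A * v = U * (rect_diag n n n d * (ctr U * v))"
    unfolding AU using uc v
    by (simp add: assoc_mult_mat[of _ n n _ n _ 1] mult_carrier_mat[of _ n n])
  moreover have "rect_diag n n n d * unit_col n p = d p \<cdot>\<^sub>m unit_col n p" using p
    by (intro eq_matI)
       (auto simp: rect_diag_def unit_col_def scalar_prod_def if_distrib cong: if_cong)
  ultimately have "ctr v * v = 1\<^sub>m 1" "A * v = d p \<cdot>\<^sub>m v"
    using uc by (simp_all only: Uv) (simp add: v_def mult_smult_distrib[of _ n n _ 1])
  thus ?thesis using v p by blast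
qed

section \<open>Dual complex matrices\<close>

lemma dual_complex_sel [simp]:
  "std_part 0 = 0" "dual_part 0 = 0" "std_part 1 = 1" "dual_part 1 = 0"
  "std_part (x + y) = std_part x + std_part y" "dual_part (x + y) = dual_part x + dual_part y"
  "std_part (x - y) = std_part x - std_part y" "dual_part (x - y) = dual_part x - dual_part y"
  "std_part (- x) = - std_part x" "dual_part (- x) = - dual_part x"
  "std_part (x * y) = std_part x * std_part y"
  "dual_part (x * y) = std_part x * dual_part y + dual_part x * std_part y"
  "std_part (conjugate x) = cnj (std_part x)" "dual_part (conjugate x) = cnj (dual_part x)"
  by (simp_all add: zero_dual_complex_def one_dual_complex_def plus_dual_complex_def
    minus_dual_complex_def uminus_dual_complex_def times_dual_complex_def conjugate_dual_complex_def)

lemma dual_complex_eq_iff: "x = y \<longleftrightarrow> std_part x = std_part y \<and> dual_part x = dual_part y"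
  using dual_complex.expand by auto

lemma std_part_sum: "std_part (sum f S) = (\<Sum>x\<in>S. std_part (f x))"
  by (induction S rule: infinite_finite_induct) auto

lemma dual_part_sum: "dual_part (sum f S) = (\<Sum>x\<in>S. dual_part (f x))"
  by (induction S rule: infinite_finite_induct) auto

text \<open>The inverse is a geometric series that stops after its linear term because
  \<open>dual_eps\<close> squares to zero.\<close>

lemma dual_complex_unit:
  assumes "std_part x \<noteq> 0"
  shows "x dvd 1"
proof -
  have "x * DC (1 / std_part x) (- dual_part x / (std_part x)\<^sup>2) = 1"
    using assms by (simp add: dual_complex_eq_iff field_simps power2_eq_square)
  thus ?thesis by (metis dvd_triv_left)
qed

lemma dual_unitary_completion:
  fixes v :: "dual_complex mat"
  assumes "v \<in> carrier_mat n 1" "ctr v * v = 1\<^sub>m 1" "n > 0"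
  shows "\<exists>U. unitary n U \<and> U * unit_col n 0 = v"
proof (rule unitary_completion[OF assms])
  \<comment> \<open>The two standard parts add up to \<open>2\<close>, so they cannot both
    vanish.\<close>
  have "std_part (1 - v $$ (0, 0)) \<noteq> 0 \<or> std_part (1 + v $$ (0, 0)) \<noteq> 0"
    by (auto simp: eq_neg_iff_add_eq_0)
  thus "1 - v $$ (0, 0) dvd 1 \<or> 1 + v $$ (0, 0) dvd 1" using dual_complex_unit by blast
qed

section \<open>Standard parts and constant dual matrices\<close>

definition std_mat :: "dual_complex mat \<Rightarrow> complex mat" where
  "std_mat = map_mat std_part"

text \<open>Used to lift a unitary matrix that diagonalizes a standard part to the dual complex
  numbers.\<close>

definition emb_mat :: "complex mat \<Rightarrow> dual_complex mat" where
  "emb_mat = map_mat (\<lambda>z. DC z 0)"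

interpretation std: semiring_hom std_part
  by unfold_locales auto

interpretation emb: semiring_hom "\<lambda>z. DC z 0"
  by unfold_locales (auto simp: dual_complex_eq_iff)

lemma std_mat_carrier [simp]: "std_mat A \<in> carrier_mat m n \<longleftrightarrow> A \<in> carrier_mat m n"
  by (simp add: std_mat_def)

lemma emb_mat_carrier [simp]: "emb_mat B \<in> carrier_mat m n \<longleftrightarrow> B \<in> carrier_mat m n"
  by (simp add: emb_mat_def)

lemma std_mat_mult:
  "A \<in> carrier_mat m n \<Longrightarrow> B \<in> carrier_mat n k \<Longrightarrow> std_mat (A * B) = std_mat A * std_mat B"
  unfolding std_mat_def by (rule std.mat_hom_mult)

lemma emb_mat_mult:
  "A \<in> carrier_mat m n \<Longrightarrow> B \<in> carrier_mat n k \<Longrightarrow> emb_mat (A * B) = emb_mat A * emb_mat B"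
  unfolding emb_mat_def by (rule emb.mat_hom_mult)

lemma std_mat_ctr: "std_mat (ctr A) = ctr (std_mat A)"
  by (rule eq_matI) (auto simp: std_mat_def)

lemma emb_mat_ctr: "emb_mat (ctr A) = ctr (emb_mat A)"
  by (rule eq_matI) (auto simp: emb_mat_def dual_complex_eq_iff)

lemma std_mat_emb_mat [simp]: "std_mat (emb_mat B) = B"
  by (rule eq_matI) (auto simp: emb_mat_def std_mat_def)

lemma std_mat_one [simp]: "std_mat (1\<^sub>m n) = 1\<^sub>m n"
  unfolding std_mat_def by (rule std.mat_hom_one)

lemma emb_mat_one [simp]: "emb_mat (1\<^sub>m n) = 1\<^sub>m n"
  unfolding emb_mat_def by (rule emb.mat_hom_one)

lemma unitary_emb_mat: "unitary n U \<Longrightarrow> unitary n (emb_mat U)"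
  by (intro unitaryI)
     (auto simp: unitary_def emb_mat_ctr[symmetric] emb_mat_mult[of _ n n, symmetric])

lemma unitary_std_mat: "unitary n U \<Longrightarrow> unitary n (std_mat U)"
  by (intro unitaryI)
     (auto simp: unitary_def std_mat_ctr[symmetric] std_mat_mult[of _ n n, symmetric])

text \<open>First-order perturbation theory: the eigenvalue \<open>d p\<close> of the diagonal standard part is
  corrected by an eigenvalue of the compression of the dual part to the eigenspace, and the
  eigenvector by the resolvent outside of it. The matrix \<open>M\<close> is this compression, shifted by
  \<open>c\<close> so that it is nonzero: an eigenvector of \<open>M\<close> for a nonzero eigenvalue is automatically
  supported on the eigenspace.\<close>

lemma dual_hermitian_eigenpair_diag:
  assumes H: "H \<in> carrier_mat n n" "ctr H = H"
    and diag: "std_mat H = rect_diag n n n d" and p: "p < n" "d p \<noteq> 0"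
  shows "\<exists>v s. v \<in> carrier_mat n 1 \<and> ctr v * v = 1\<^sub>m 1 \<and> H * v = s \<cdot>\<^sub>m v \<and> std_part s \<noteq> 0"
proof -
  define h where "h i j = dual_part (H $$ (i, j))" for i j
  define E where "E = {i. i < n \<and> d i = d p}"
  define c :: complex where "c = (if h p p = 0 then 1 else 0)"
  have std: "std_part (H $$ (i, j)) = (if i = j then d i else 0)" if "i < n" "j < n" for i j
    using arg_cong[OF diag, of "\<lambda>M. M $$ (i, j)"] H that by (auto simp: std_mat_def rect_diag_def)
  have h: "cnj (h i j) = h j i" if "i < n" "j < n" for i j
  proof -
    have "ctr H $$ (j, i) = conjugate (H $$ (i, j))" using H(1) that by auto
    thus ?thesis unfolding H(2) h_def by simp
  qed
  define M where
    "M = mat n n (\<lambda>(i, j). if i \<in> E \<and> j \<in> E then h i j + (if i = j then c else 0) else 0)"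
  have M: "M \<in> carrier_mat n n" by (simp add: M_def)
  have "ctr M = M" using h by (intro eq_matI) (auto simp: M_def c_def)
  \<comment> \<open>By the choice of \<open>c\<close> this entry is \<open>h p p\<close> if that is
    nonzero, and \<open>1\<close> otherwise.\<close>
  moreover have "M $$ (p, p) \<noteq> 0" using p by (auto simp: M_def E_def c_def)
  hence "M \<noteq> 0\<^sub>m n n" using p by auto
  ultimately obtain x b where x: "x \<in> carrier_mat n 1" "ctr x * x = 1\<^sub>m 1" "M * x = b \<cdot>\<^sub>m x"
    and b: "b \<noteq> 0"
    using complex_hermitian_nonzero_eigenvalue[OF M] by auto
  have Mx: "(\<Sum>k<n. M $$ (i, k) * x $$ (k, 0)) = b * x $$ (i, 0)" if "i < n" for i
    using arg_cong[OF x(3), of "\<lambda>M. M $$ (i, 0)"] index_mult_mat_sum[OF M x(1) that] x(1) that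
    by auto
  have x0: "x $$ (i, 0) = 0" if "i < n" "i \<notin> E" for i
    using Mx[OF that(1)] b that by (auto simp: M_def)
  define g where "g i = (\<Sum>k<n. h i k * x $$ (k, 0))" for i
  \<comment> \<open>On the eigenspace the shift by \<open>c\<close> is undone: \<open>x\<close> is
    an eigenvector of the unshifted compression for \<open>b - c\<close>.\<close>
  have gE: "g i = (b - c) * x $$ (i, 0)" if "i \<in> E" for i
  proof -
    have i: "i < n" using that by (simp add: E_def)
    have "b * x $$ (i, 0) = (\<Sum>k<n. h i k * x $$ (k, 0) + (if k = i then c * x $$ (k, 0) else 0))"
      unfolding Mx[OF i, symmetric]
      by (intro sum.cong) (use i that x0 in \<open>auto simp: M_def algebra_simps\<close>)
    also have "\<dots> = g i + c * x $$ (i, 0)" using i by (simp add: sum.distrib g_def)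
    finally show ?thesis by (simp add: algebra_simps)
  qed
  \<comment> \<open>Outside \<open>E\<close>, where \<open>x\<close> vanishes, \<open>y\<close>
    solves the dual part \<open>d i * y i + g i = d p * y i\<close> of the eigenvalue equation. It
    is zero on \<open>E\<close>, so \<open>x\<close> and \<open>y\<close> have disjoint supports and
    \<open>v\<close> keeps unit length.\<close>
  define y where "y i = (if i \<in> E then 0 else g i / (d p - d i))" for i
  define v where "v = mat n 1 (\<lambda>(i, j). DC (x $$ (i, 0)) (y i))"
  define s where "s = DC (d p) (b - c)"
  have v: "v \<in> carrier_mat n 1" by (simp add: v_def)
  have xx: "(\<Sum>k<n. cnj (x $$ (k, 0)) * x $$ (k, 0)) = 1"
  proof -
    have "(ctr x * x) $$ (0, 0) = (\<Sum>k<n. cnj (x $$ (k, 0)) * x $$ (k, 0))"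
      using x(1) by (subst index_mult_mat_sum[of _ 1 n _ 1]) auto
    thus ?thesis using x(2) by simp
  qed
  have xy: "x $$ (k, 0) = 0 \<or> y k = 0" if "k < n" for k
    using x0[OF that] by (auto simp: y_def)
  have "(ctr v * v) $$ (0, 0) = (\<Sum>k<n. conjugate (v $$ (k, 0)) * v $$ (k, 0))"
    using v by (subst index_mult_mat_sum[of _ 1 n _ 1]) auto
  also have "\<dots> = 1"
    unfolding dual_complex_eq_iff std_part_sum dual_part_sum
  proof
    show "(\<Sum>k<n. std_part (conjugate (v $$ (k, 0)) * v $$ (k, 0))) = std_part 1"
      using xx by (simp add: v_def)
    show "(\<Sum>k<n. dual_part (conjugate (v $$ (k, 0)) * v $$ (k, 0))) = dual_part 1"
      unfolding dual_complex_sel by (rule sum.neutral) (use xy in \<open>force simp: v_def\<close>)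
  qed
  finally have "ctr v * v = 1\<^sub>m 1" using v by (intro eq_matI) auto
  moreover have "H * v = s \<cdot>\<^sub>m v"
  proof (rule eq_matI)
    fix i j assume "i < dim_row (s \<cdot>\<^sub>m v)" "j < dim_col (s \<cdot>\<^sub>m v)"
    hence i: "i < n" "j = 0" using v by auto
    have e: "(H * v) $$ (i, 0) = (\<Sum>k<n. H $$ (i, k) * v $$ (k, 0))"
      using i by (intro index_mult_mat_sum[OF H(1) v]) auto
    have "std_part ((H * v) $$ (i, 0)) = (\<Sum>k<n. if k = i then d i * x $$ (i, 0) else 0)"
      unfolding e std_part_sum using i by (intro sum.cong) (auto simp: std v_def)
    also have "\<dots> = d p * x $$ (i, 0)" using i x0[of i] by (auto simp: E_def)
    finally have 1: "std_part ((H * v) $$ (i, 0)) = d p * x $$ (i, 0)" .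
    have "dual_part ((H * v) $$ (i, 0)) =
        (\<Sum>k<n. (if k = i then d i * y i else 0) + h i k * x $$ (k, 0))"
      unfolding e dual_part_sum using i by (intro sum.cong) (auto simp: std v_def h_def)
    also have "\<dots> = d i * y i + g i" using i by (simp add: sum.distrib g_def)
    also have "\<dots> = d p * y i + (b - c) * x $$ (i, 0)"
    proof (cases "i \<in> E")
      case True
      thus ?thesis using gE[OF True] by (simp add: y_def)
    next
      case False
      hence "d p - d i \<noteq> 0" using i by (auto simp: E_def)
      hence "g i = (d p - d i) * y i" using False by (simp add: y_def)
      thus ?thesis using x0[OF i(1) False] by (simp add: algebra_simps)
    qed
    finally show "(H * v) $$ (i, j) = (s \<cdot>\<^sub>m v) $$ (i, j)"
      using 1 i v by (simp add: dual_complex_eq_iff) (simp add: v_def s_def)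
  qed (use H v in auto)
  moreover have "std_part s \<noteq> 0" using p by (simp add: s_def)
  ultimately show ?thesis using v by blast
qed

text \<open>Reduction to a diagonal standard part: conjugation by the constant matrix
  \<open>W\<close> diagonalizes it, and the eigenvector found there is carried back by
  \<open>W\<close>.\<close>

lemma dual_hermitian_eigenpair:
  assumes H: "H \<in> carrier_mat n n" "ctr H = H" and nz: "std_mat H \<noteq> 0\<^sub>m n n"
  shows "\<exists>v s. v \<in> carrier_mat n 1 \<and> ctr v * v = 1\<^sub>m 1 \<and> H * v = s \<cdot>\<^sub>m v \<and> std_part s \<noteq> 0"
proof -
  have "ctr (std_mat H) = std_mat H" using H(2) by (metis std_mat_ctr)
  then obtain U d where U: "unitary n U" and HU: "std_mat H = U * rect_diag n n n d * ctr U"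
    using complex_spectral_theorem[of "std_mat H" n] H by auto
  note uc = unitaryD(1)[OF U]
  have "\<exists>p<n. d p \<noteq> 0"
  proof (rule ccontr)
    assume "\<not> ?thesis"
    hence "rect_diag n n n d = 0\<^sub>m n n" by (intro eq_matI) (auto simp: rect_diag_def)
    thus False using HU nz uc by auto
  qed
  then obtain p where p: "p < n" "d p \<noteq> 0" by blast
  define W where "W = emb_mat U"
  have W: "unitary n W" unfolding W_def by (rule unitary_emb_mat[OF U])
  note wc = unitaryD(1)[OF W]
  define F where "F = ctr W * H * W"
  have F: "F \<in> carrier_mat n n" using H wc by (auto simp: F_def)
  have hF: "ctr F = F" using H wc unfolding F_def
    by (simp add: ctr_mult[of _ n n _ n] assoc_mult_mat[of _ n n _ n _ n] mult_carrier_mat[of _ n n])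
  have "std_mat F = ctr U * std_mat H * U"
    using H wc uc unfolding F_def
    by (simp add: std_mat_mult[of _ n n _ n] std_mat_ctr W_def)
  also have "\<dots> = ctr U * (U * (rect_diag n n n d * (ctr U * U)))"
    using uc unfolding HU by (simp add: assoc_mult_mat[of _ n n _ n _ n] mult_carrier_mat[of _ n n])
  also have "\<dots> = rect_diag n n n d"
    using unitary_cancel(1)[OF U, of "rect_diag n n n d" n] unitaryD(2)[OF U]
    by (simp add: right_mult_one_mat[of _ n n])
  finally have "std_mat F = rect_diag n n n d" .
  then obtain v s where v: "v \<in> carrier_mat n 1" "ctr v * v = 1\<^sub>m 1" "F * v = s \<cdot>\<^sub>m v"
    and s: "std_part s \<noteq> 0"
    using dual_hermitian_eigenpair_diag[OF F hF _ p(1)] p(2) by blast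
  have Wv: "W * v \<in> carrier_mat n 1" using wc v by auto
  have "ctr (W * v) * (W * v) = ctr v * (ctr W * (W * v))"
    using wc v Wv by (simp add: ctr_mult[of _ n n _ 1] assoc_mult_mat[of _ 1 n _ n _ 1])
  also have "\<dots> = 1\<^sub>m 1" using unitary_cancel(1)[OF W v(1)] v(2) by simp
  finally have 1: "ctr (W * v) * (W * v) = 1\<^sub>m 1" .
  have HWv: "H * (W * v) \<in> carrier_mat n 1" using H Wv by auto
  have "H * (W * v) = W * (ctr W * (H * (W * v)))"
    using unitary_cancel(2)[OF W HWv] by simp
  also have "ctr W * (H * (W * v)) = F * v"
    using H wc v Wv unfolding F_def
    by (simp add: assoc_mult_mat[of _ n n _ n _ n] assoc_mult_mat[of _ n n _ n _ 1] mult_carrier_mat[of _ n n])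
  also have "W * (F * v) = s \<cdot>\<^sub>m (W * v)"
    unfolding v(3) using wc v(1) by (simp add: mult_smult_distrib[of _ n n _ 1])
  finally show ?thesis using 1 Wv s by blast
qed

section \<open>Dual singular value decomposition\<close>

lemma adj_eq_ctr: "adj A = ctr A"
  by (simp add: adj_def ctr_def)

lemma unitary_mats_iff: "U \<in> unitary_mats n \<longleftrightarrow> unitary n U"
  by (auto simp: unitary_mats_def unitary_def inverts_mat_def adj_eq_ctr)

lemma smult_smult_mat: "a \<cdot>\<^sub>m (b \<cdot>\<^sub>m A) = (a * b :: 'a::semigroup_mult) \<cdot>\<^sub>m A"
  by (rule eq_matI) (auto simp: mult.assoc)

lemma one_smult_mat [simp]: "1 \<cdot>\<^sub>m A = (A :: 'a::monoid_mult mat)"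
  by (rule eq_matI) auto

section \<open>Singular triples\<close>

text \<open>The eigenvalue is the squared length of \<open>A * v\<close>, whose standard part is a
  sum of squared moduli.\<close>

lemma gram_eigenvector:
  assumes A: "A \<in> carrier_mat m n" and v: "v \<in> carrier_mat n 1"
    and unit: "ctr v * v = 1\<^sub>m 1" and ev: "ctr A * A * v = s \<cdot>\<^sub>m v"
  shows "ctr (A * v) * (A * v) = s \<cdot>\<^sub>m 1\<^sub>m 1" "0 \<le> Re (std_part s)"
proof -
  have Av: "A * v \<in> carrier_mat m 1" using A v by auto
  have "ctr (A * v) * (A * v) = ctr v * (ctr A * A * v)"
    using A v Av by (simp add: ctr_mult[of _ m n _ 1] assoc_mult_mat[of _ 1 n _ m _ 1]
      assoc_mult_mat[of _ n m _ n _ 1])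
  also have "\<dots> = s \<cdot>\<^sub>m 1\<^sub>m 1"
    unfolding ev using v by (simp add: mult_smult_distrib[of _ 1 n _ 1] unit)
  finally show eq: "ctr (A * v) * (A * v) = s \<cdot>\<^sub>m 1\<^sub>m 1" .
  define w where "w = A * v"
  have w: "w \<in> carrier_mat m 1" using Av by (simp add: w_def)
  have "s = (ctr w * w) $$ (0, 0)" unfolding w_def eq by simp
  also have "\<dots> = (\<Sum>k<m. ctr w $$ (0, k) * w $$ (k, 0))"
    by (rule index_mult_mat_sum[of _ 1 m _ 1]) (use w in auto)
  also have "std_part \<dots> = (\<Sum>k<m. cnj (std_part (w $$ (k, 0))) * std_part (w $$ (k, 0)))"
    unfolding std_part_sum using w by (intro sum.cong) auto
  finally have "Re (std_part s) =
      (\<Sum>k<m. Re (cnj (std_part (w $$ (k, 0))) * std_part (w $$ (k, 0))))" by simp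
  also have "\<dots> \<ge> 0" by (intro sum_nonneg) simp
  finally show "0 \<le> Re (std_part s)" .
qed

text \<open>For a unit eigenvector \<open>v\<close> of \<open>ctr A * A\<close> with appreciable
  eigenvalue \<open>l\<close>, the singular value is the dual square root of \<open>l\<close>, and
  \<open>u\<close> is \<open>A * v\<close> divided by it.\<close>

lemma singular_triple_appreciable:
  assumes A: "A \<in> carrier_mat m n" and nz: "std_mat A \<noteq> 0\<^sub>m m n"
  shows "\<exists>s u v. dual_pos s \<and> appreciable s \<and> u \<in> carrier_mat m 1 \<and> v \<in> carrier_mat n 1 \<and>
    ctr u * u = 1\<^sub>m 1 \<and> ctr v * v = 1\<^sub>m 1 \<and> A * v = s \<cdot>\<^sub>m u \<and> ctr A * u = s \<cdot>\<^sub>m v"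
proof -
  define H where "H = ctr A * A"
  have H: "H \<in> carrier_mat n n" "ctr H = H"
    using A by (auto simp: H_def ctr_mult[of _ n m _ n])
  \<comment> \<open>A diagonal entry of this matrix is the squared norm of a column of
    \<open>std_mat A\<close>; it is nonzero for a nonzero column.\<close>
  have "std_mat H \<noteq> 0\<^sub>m n n"
  proof
    assume z: "std_mat H = 0\<^sub>m n n"
    obtain i j where ij: "i < m" "j < n" "std_part (A $$ (i, j)) \<noteq> 0"
      using nz A by (auto simp: std_mat_def mat_eq_iff)
    have "std_mat H $$ (j, j) = std_part (\<Sum>k<m. ctr A $$ (j, k) * A $$ (k, j))"
      unfolding H_def std_mat_def using A ij
      by (auto simp del: index_mult_mat(1) simp: index_mult_mat_sum[of _ n m _ n])
    also have "\<dots> = (\<Sum>k<m. of_real ((cmod (std_part (A $$ (k, j))))\<^sup>2))"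
      unfolding std_part_sum using A ij
      by (intro sum.cong refl) (auto simp: complex_norm_square mult.commute simp del: of_real_power)
    also have "\<dots> = of_real (\<Sum>k<m. (cmod (std_part (A $$ (k, j))))\<^sup>2)" by simp
    finally have "(\<Sum>k<m. (cmod (std_part (A $$ (k, j))))\<^sup>2) = 0"
      using z ij by (simp del: of_real_sum)
    hence "\<forall>k\<in>{..<m}. (cmod (std_part (A $$ (k, j))))\<^sup>2 = 0"
      by (subst (asm) sum_nonneg_eq_0_iff) auto
    thus False using ij by auto
  qed
  from dual_hermitian_eigenpair[OF H this] obtain v l where
    v: "v \<in> carrier_mat n 1" "ctr v * v = 1\<^sub>m 1" "H * v = l \<cdot>\<^sub>m v" and l0: "std_part l \<noteq> 0" by blast
  have l: "conjugate l = l" by (rule hermitian_eigenvalue_real[OF H v])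
  note g = gram_eigenvector[OF A v(1,2) v(3)[unfolded H_def]]
  define a where "a = Re (std_part l)"
  define b where "b = Re (dual_part l)"
  have lab: "l = DC a b" and "Im (std_part l) = 0"
    using l by (auto simp: dual_complex_eq_iff a_def b_def complex_eq_iff)
  hence a: "a > 0" using l0 g(2) by (auto simp: a_def complex_eq_iff less_le)
  define q where "q = sqrt a"
  have q: "q > 0" using a by (simp add: q_def)
  have l_eq: "l = DC (complex_of_real q * q) b" using a unfolding lab q_def
    by (simp flip: of_real_mult)
  \<comment> \<open>To first order in \<open>dual_eps\<close>: \<open>s\<close> squares to
    \<open>l\<close>, and \<open>r\<close> is the inverse of \<open>s\<close>.\<close>
  define s where "s = DC q (b / (2 * q))"
  define r where "r = DC (1 / q) (- b / (2 * q * q * q))"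
  have sr: "s * r = 1" "conjugate r = r" "conjugate s = s" "r * l = s" "r * r * l = 1"
    using q by (simp_all add: s_def r_def l_eq dual_complex_eq_iff field_simps)
  have s: "dual_pos s" "appreciable s"
    using q by (auto simp: appreciable_def dual_pos_def s_def
      dual_number_def dual_le_def dual_complex_eq_iff)
  define u where "u = r \<cdot>\<^sub>m (A * v)"
  have Av: "A * v \<in> carrier_mat m 1" using A v(1) by auto
  have u: "u \<in> carrier_mat m 1" using Av by (simp add: u_def)
  have "ctr u * u = (r * r) \<cdot>\<^sub>m (ctr (A * v) * (A * v))"
    unfolding u_def ctr_smult sr(2) using Av
    by (simp add: mult_smult_distrib[of _ 1 m _ 1] mult_smult_assoc_mat[of _ 1 m _ 1]
      smult_smult_mat)
  also have "\<dots> = (r * r * l) \<cdot>\<^sub>m 1\<^sub>m 1" unfolding g(1) by (simp add: smult_smult_mat)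
  finally have "ctr u * u = 1\<^sub>m 1" by (simp add: sr(5))
  moreover have "A * v = s \<cdot>\<^sub>m u" by (simp add: u_def smult_smult_mat sr(1))
  moreover have "ctr A * u = r \<cdot>\<^sub>m (H * v)"
    unfolding u_def H_def using A v(1) Av
    by (simp add: mult_smult_distrib[of _ n m _ 1] assoc_mult_mat[of _ n m _ n _ 1])
  hence "ctr A * u = s \<cdot>\<^sub>m v" unfolding v(3) by (simp add: smult_smult_mat sr(4))
  ultimately show ?thesis using s u v(1,2) by blast
qed

text \<open>An infinitesimal matrix is \<open>\<epsilon>\<close> times a matrix with nonzero standard part, whose singular
  vectors it shares.\<close>

lemma singular_triple:
  assumes A: "A \<in> carrier_mat m n" and nz: "A \<noteq> 0\<^sub>m m n"
  shows "\<exists>s u v. dual_pos s \<and> u \<in> carrier_mat m 1 \<and> v \<in> carrier_mat n 1 \<and>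
    ctr u * u = 1\<^sub>m 1 \<and> ctr v * v = 1\<^sub>m 1 \<and> A * v = s \<cdot>\<^sub>m u \<and> ctr A * u = s \<cdot>\<^sub>m v"
proof (cases "std_mat A = 0\<^sub>m m n")
  case False
  thus ?thesis using singular_triple_appreciable[OF A] by blast
next
  case True
  define B where "B = map_mat (\<lambda>z. DC (dual_part z) 0) A"
  have B: "B \<in> carrier_mat m n" using A by (simp add: B_def)
  have 0: "std_part (A $$ (i, j)) = 0" if "i < m" "j < n" for i j
    using arg_cong[OF True, of "\<lambda>M. M $$ (i, j)"] A that by (simp add: std_mat_def)
  have AB: "A = dual_eps \<cdot>\<^sub>m B"
    using A 0 by (intro eq_matI) (auto simp: B_def dual_eps_def dual_complex_eq_iff)
  have eps: "conjugate dual_eps = dual_eps" by (simp add: dual_eps_def dual_complex_eq_iff)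
  have "std_mat B \<noteq> 0\<^sub>m m n"
  proof
    assume z: "std_mat B = 0\<^sub>m m n"
    have "dual_part (A $$ (i, j)) = 0" if "i < m" "j < n" for i j
      using arg_cong[OF z, of "\<lambda>M. M $$ (i, j)"] A that by (simp add: std_mat_def B_def)
    hence "A = 0\<^sub>m m n" using A 0 by (intro eq_matI) (auto simp: dual_complex_eq_iff)
    thus False using nz by simp
  qed
  from singular_triple_appreciable[OF B this] obtain s u v where
    s: "dual_pos s" "appreciable s" and u: "u \<in> carrier_mat m 1" "ctr u * u = 1\<^sub>m 1"
    and v: "v \<in> carrier_mat n 1" "ctr v * v = 1\<^sub>m 1"
    and Bv: "B * v = s \<cdot>\<^sub>m u" and Bu: "ctr B * u = s \<cdot>\<^sub>m v" by blast
  \<comment> \<open>The product has standard part zero, and its dual part is the standard part of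
    \<open>s\<close>, which is positive because \<open>s\<close> is appreciable.\<close>
  have "dual_pos (dual_eps * s)"
    using s by (auto simp: dual_pos_def dual_number_def dual_le_def dual_complex_eq_iff
      dual_eps_def appreciable_def complex_eq_iff complex_is_Real_iff)
  moreover have "A * v = (dual_eps * s) \<cdot>\<^sub>m u"
    unfolding AB using B v(1) Bv by (simp add: mult_smult_assoc_mat[of _ m n _ 1] smult_smult_mat)
  moreover have "ctr A * u = (dual_eps * s) \<cdot>\<^sub>m v"
    unfolding AB ctr_smult eps using B u(1) Bu
    by (simp add: mult_smult_assoc_mat[of _ n m _ 1] smult_smult_mat)
  ultimately show ?thesis using u v by blast
qed

text \<open>Induction on the number of rows: a zero matrix has no singular values, and from a
  nonzero one a singular triple is split off. The order of the values is left open here.\<close>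

lemma rect_diag_svd:
  assumes "A \<in> carrier_mat m n"
  shows "\<exists>P V t \<mu>. unitary m P \<and> unitary n V \<and> t \<le> m \<and> t \<le> n \<and> (\<forall>i<t. dual_pos (\<mu> i)) \<and>
    A = P * rect_diag m n t \<mu> * ctr V"
  using assms
proof (induction m arbitrary: n A)
  case 0
  thus ?case
    by (intro exI[of _ "1\<^sub>m 0"] exI[of _ "1\<^sub>m n"] exI[of _ 0] exI[of _ "\<lambda>_. 0"]) auto
next
  case (Suc m)
  show ?case
  proof (cases "A = 0\<^sub>m (Suc m) n")
    case True
    have "rect_diag (Suc m) n 0 (\<lambda>_. 0) = (0\<^sub>m (Suc m) n :: dual_complex mat)"
      by (intro eq_matI) (auto simp: rect_diag_def)
    thus ?thesis using True
      by (intro exI[of _ "1\<^sub>m (Suc m)"] exI[of _ "1\<^sub>m n"] exI[of _ 0] exI[of _ "\<lambda>_. 0"]) auto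
  next
    case False
    \<comment> \<open>A matrix without columns would equal the zero matrix.\<close>
    then obtain n' where n: "n = Suc n'" using Suc.prems by (cases n) (auto intro!: eq_matI)
    note A = Suc.prems[unfolded n]
    obtain s u v where s: "dual_pos s" and u: "u \<in> carrier_mat (Suc m) 1" "ctr u * u = 1\<^sub>m 1"
      and v: "v \<in> carrier_mat (Suc n') 1" "ctr v * v = 1\<^sub>m 1"
      and Av: "A * v = s \<cdot>\<^sub>m u" and Au: "ctr A * u = s \<cdot>\<^sub>m v"
      using singular_triple[OF A] False n by blast
    have cs: "conjugate s = s"
      using s by (auto simp: dual_pos_def dual_number_def dual_complex_eq_iff Reals_cnj_iff)
    obtain U where U: "unitary (Suc m) U" "U * unit_col (Suc m) 0 = u"
      using dual_unitary_completion[OF u] by auto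
    obtain V where V: "unitary (Suc n') V" "V * unit_col (Suc n') 0 = v"
      using dual_unitary_completion[OF v] by auto
    obtain A' where A': "A' \<in> carrier_mat m n'" and F: "ctr U * A * V = bordered s A'"
      using deflation[OF A U V Av Au cs] by blast
    obtain P Q t \<mu> where P: "unitary m P" and Q: "unitary n' Q" and t: "t \<le> m" "t \<le> n'"
      and \<mu>: "\<forall>i<t. dual_pos (\<mu> i)" and PQ: "A' = P * rect_diag m n' t \<mu> * ctr Q"
      using Suc.IH[OF A'] by blast
    show ?thesis
      using deflation_compose[OF A U(1) V(1) F P Q PQ] n t s \<mu>
        unitary_mult[OF U(1) unitary_bordered[OF P]] unitary_mult[OF V(1) unitary_bordered[OF Q]]
      by (intro exI[of _ "U * bordered 1 P"] exI[of _ "V * bordered 1 Q"] exI[of _ "Suc t"]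
        exI[of _ "case_nat s \<mu>"]) (auto split: nat.split simp: less_Suc_eq_0_disj)
  qed
qed

section \<open>Sorting the singular values\<close>

lemma permute_columns_unitary:
  assumes U: "unitary m U" and p: "bij_betw p {..<m} {..<m}"
  shows "unitary m (mat m m (\<lambda>(i, j). U $$ (i, p j)))" (is "unitary m ?V")
proof (rule unitaryI)
  note uc = unitaryD(1)[OF U]
  have pm: "p i < m" if "i < m" for i using bij_betwE[OF p] that by auto
  show "ctr ?V * ?V = 1\<^sub>m m"
  proof (rule eq_matI)
    fix i j assume "i < dim_row (1\<^sub>m m :: 'a mat)" "j < dim_col (1\<^sub>m m :: 'a mat)"
    hence ij: "i < m" "j < m" by auto
    have "(ctr ?V * ?V) $$ (i, j) = (\<Sum>k<m. ctr ?V $$ (i, k) * ?V $$ (k, j))"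
      by (rule index_mult_mat_sum[of _ m m _ m]) (use ij in auto)
    also have "\<dots> = (\<Sum>k<m. ctr U $$ (p i, k) * U $$ (k, p j))"
      using ij uc pm by (intro sum.cong) auto
    also have "\<dots> = (ctr U * U) $$ (p i, p j)"
      by (rule index_mult_mat_sum[of _ m m _ m, symmetric]) (use ij uc pm in auto)
    also have "\<dots> = 1\<^sub>m m $$ (i, j)"
      using unitaryD(2)[OF U] ij pm inj_onD[OF bij_betw_imp_inj_on[OF p], of i j] by auto
    finally show "(ctr ?V * ?V) $$ (i, j) = 1\<^sub>m m $$ (i, j)" .
  qed auto
qed auto

text \<open>The product as a sum of one term per singular value, which shows that a simultaneous
  permutation of values and singular vectors leaves it unchanged.\<close>

lemma index_rect_diag_sandwich:
  fixes P V :: "'a::{conjugatable_ring,comm_ring_1} mat"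
  assumes P: "P \<in> carrier_mat m m" and V: "V \<in> carrier_mat n n"
    and t: "t \<le> m" "t \<le> n" and ij: "i < m" "j < n"
  shows "(P * rect_diag m n t \<mu> * ctr V) $$ (i, j)
    = (\<Sum>k<t. P $$ (i, k) * \<mu> k * conjugate (V $$ (j, k)))"
proof -
  have 1: "(P * rect_diag m n t \<mu>) $$ (i, k) = (if k < t then P $$ (i, k) * \<mu> k else 0)"
    if "k < n" for k
  proof -
    have "(P * rect_diag m n t \<mu>) $$ (i, k) = (\<Sum>l<m. P $$ (i, l) * rect_diag m n t \<mu> $$ (l, k))"
      using P that ij(1) by (intro index_mult_mat_sum[of _ m m _ n]) auto
    also have "\<dots> = (\<Sum>l<m. if l = k then (if k < t then P $$ (i, k) * \<mu> k else 0) else 0)"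
      using that by (intro sum.cong) (auto simp: rect_diag_def)
    finally show ?thesis using t by auto
  qed
  have "(P * rect_diag m n t \<mu> * ctr V) $$ (i, j)
      = (\<Sum>k<n. (P * rect_diag m n t \<mu>) $$ (i, k) * ctr V $$ (k, j))"
    by (rule index_mult_mat_sum[of _ m n _ n]) (use P V ij in auto)
  also have "\<dots> = (\<Sum>k<n. if k \<in> {..<t} then P $$ (i, k) * \<mu> k * conjugate (V $$ (j, k)) else 0)"
    using V ij 1 by (intro sum.cong) auto
  also have "\<dots> = (\<Sum>k\<in>{..<n} \<inter> {..<t}. P $$ (i, k) * \<mu> k * conjugate (V $$ (j, k)))"
    by (rule sum.inter_restrict[symmetric]) simp
  also have "{..<n} \<inter> {..<t} = {..<t}" using t by auto
  finally show ?thesis .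
qed

lemma four_block_rect_diag:
  assumes "t \<le> m" "t \<le> n"
  shows "four_block_mat (mat_diag t \<mu>) (0\<^sub>m t (n - t)) (0\<^sub>m (m - t) t) (0\<^sub>m (m - t) (n - t))
    = rect_diag m n t \<mu>"
  using assms by (intro eq_matI) (auto simp: mat_diag_def rect_diag_def)

lemma dual_svd_iff:
  assumes "A \<in> carrier_mat m n"
  shows "dual_svd A t \<mu> P V \<longleftrightarrow> t \<le> m \<and> t \<le> n \<and> unitary m P \<and> unitary n V \<and>
    (\<forall>i<t. dual_pos (\<mu> i)) \<and> (\<forall>i j. i \<le> j \<longrightarrow> j < t \<longrightarrow> dual_le (\<mu> j) (\<mu> i)) \<and>
    A = P * rect_diag m n t \<mu> * ctr V"
  using assms by (auto simp: dual_svd_def unitary_mats_iff four_block_rect_diag adj_eq_ctr)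

text \<open>\<open>dual_le\<close> is the lexicographic order on the pair \<open>key\<close>, so the
  indices can be sorted by it. Sorting is ascending, whence the reversal in
  \<open>p\<close>.\<close>

lemma dual_sorting_permutation:
  fixes \<mu> :: "nat \<Rightarrow> dual_complex"
  shows "\<exists>p. bij_betw p {..<t} {..<t} \<and> (\<forall>i j. i \<le> j \<longrightarrow> j < t \<longrightarrow> dual_le (\<mu> (p j)) (\<mu> (p i)))"
proof -
  define key where "key i = (Re (std_part (\<mu> i)), Re (dual_part (\<mu> i)))" for i
  have le: "dual_le (\<mu> i) (\<mu> j) \<longleftrightarrow> key i \<le> key j" for i j
    unfolding dual_le_def key_def less_eq_prod_simp by linarith
  define ys where "ys = sort_key key [0..<t]"
  have ys: "length ys = t" "distinct ys" "set ys = {..<t}" "sorted (map key ys)"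
    by (auto simp: ys_def)
  define p where "p i = rev ys ! i" for i
  have "bij_betw p {..<t} {..<t}"
    unfolding p_def[abs_def] by (rule bij_betw_nth) (use ys(1-3) in simp_all)
  moreover have "dual_le (\<mu> (p j)) (\<mu> (p i))" if "i \<le> j" "j < t" for i j
    unfolding le p_def using that ys(1) sorted_nth_mono[OF ys(4), of "t - Suc j" "t - Suc i"]
    by (simp add: rev_nth)
  ultimately show ?thesis by blast
qed

theorem dual_svd_exists:
  assumes A: "A \<in> carrier_mat m n"
  shows "\<exists>t \<mu> P V. dual_svd A t \<mu> P V"
proof -
  obtain P V t \<mu> where P: "unitary m P" and V: "unitary n V" and t: "t \<le> m" "t \<le> n"
    and \<mu>: "\<forall>i<t. dual_pos (\<mu> i)" and AP: "A = P * rect_diag m n t \<mu> * ctr V"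
    using rect_diag_svd[OF A] by blast
  obtain p where p: "bij_betw p {..<t} {..<t}"
    and sorted: "\<forall>i j. i \<le> j \<longrightarrow> j < t \<longrightarrow> dual_le (\<mu> (p j)) (\<mu> (p i))"
    using dual_sorting_permutation by blast
  have pt: "p i < t" if "i < t" for i using bij_betwE[OF p] that by auto
  \<comment> \<open>\<open>p\<close> moves only the first \<open>t\<close> indices; extended by the
    identity it permutes the columns of \<open>P\<close> and of \<open>V\<close> alike, although
    their numbers may differ.\<close>
  define q where "q i = (if i \<in> {..<t} then p i else id i)" for i
  have q: "bij_betw q {..<k} {..<k}" if "t \<le> k" for k
  proof -
    have "bij_betw q ({..<t} \<union> {t..<k}) ({..<t} \<union> {t..<k})"
      unfolding q_def[abs_def] by (rule bij_betw_disjoint_Un[OF p bij_betw_id]) auto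
    moreover have "{..<t} \<union> {t..<k} = {..<k}" using that by auto
    ultimately show ?thesis by simp
  qed
  define P' where "P' = mat m m (\<lambda>(i, j). P $$ (i, q j))"
  define V' where "V' = mat n n (\<lambda>(i, j). V $$ (i, q j))"
  have u: "unitary m P'" "unitary n V'"
    unfolding P'_def V'_def using permute_columns_unitary[OF P q[OF t(1)]]
      permute_columns_unitary[OF V q[OF t(2)]] by auto
  have "A = P' * rect_diag m n t (\<lambda>i. \<mu> (p i)) * ctr V'"
  proof (rule eq_matI)
    fix i j
    assume "i < dim_row (P' * rect_diag m n t (\<lambda>i. \<mu> (p i)) * ctr V')"
      "j < dim_col (P' * rect_diag m n t (\<lambda>i. \<mu> (p i)) * ctr V')"
    hence ij: "i < m" "j < n" using unitaryD(1)[OF u(1)] unitaryD(1)[OF u(2)] by auto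
    have "A $$ (i, j) = (\<Sum>k<t. P $$ (i, k) * \<mu> k * conjugate (V $$ (j, k)))"
      unfolding AP by (rule index_rect_diag_sandwich[OF unitaryD(1)[OF P] unitaryD(1)[OF V] t ij])
    also have "\<dots> = (\<Sum>k<t. P $$ (i, p k) * \<mu> (p k) * conjugate (V $$ (j, p k)))"
      by (rule sum.reindex_bij_betw[OF p, symmetric])
    also have "\<dots> = (\<Sum>k<t. P' $$ (i, k) * \<mu> (p k) * conjugate (V' $$ (j, k)))"
      using ij t by (intro sum.cong) (auto simp: P'_def V'_def q_def)
    also have "\<dots> = (P' * rect_diag m n t (\<lambda>i. \<mu> (p i)) * ctr V') $$ (i, j)"
      by (rule index_rect_diag_sandwich[OF unitaryD(1)[OF u(1)] unitaryD(1)[OF u(2)] t ij, symmetric])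
    finally show "A $$ (i, j) = (P' * rect_diag m n t (\<lambda>i. \<mu> (p i)) * ctr V') $$ (i, j)" .
  qed (use A unitaryD(1)[OF u(1)] unitaryD(1)[OF u(2)] in auto)
  hence "dual_svd A t (\<lambda>i. \<mu> (p i)) P' V'"
    unfolding dual_svd_iff[OF A] using t u \<mu> pt sorted by auto
  thus ?thesis by blast
qed

section \<open>Rank\<close>

lemma complex_unitary_column_norm:
  fixes G :: "complex mat"
  assumes G: "unitary m G" and i: "i < m"
  shows "(\<Sum>k<m. (cmod (G $$ (k, i)))\<^sup>2) = 1"
proof -
  note gc = unitaryD(1)[OF G]
  have "complex_of_real (\<Sum>k<m. (cmod (G $$ (k, i)))\<^sup>2) = (\<Sum>k<m. ctr G $$ (i, k) * G $$ (k, i))"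
    unfolding of_real_sum using gc i
    by (intro sum.cong refl) (auto simp: complex_norm_square mult.commute simp del: of_real_power)
  also have "\<dots> = (ctr G * G) $$ (i, i)"
    by (rule index_mult_mat_sum[of _ m m _ m, symmetric]) (use gc i in auto)
  also have "\<dots> = complex_of_real 1" using unitaryD(2)[OF G] i by simp
  finally show ?thesis by (simp only: of_real_eq_iff)
qed

lemma complex_unitary_row_norm:
  fixes G :: "complex mat"
  assumes G: "unitary m G" and i: "i < m"
  shows "(\<Sum>k<m. (cmod (G $$ (i, k)))\<^sup>2) = 1"
  using complex_unitary_column_norm[OF unitary_ctr[OF G] i] unitaryD(1)[OF G] i by simp

text \<open>Double counting of squared moduli: the first \<open>t\<close> columns have total
  \<open>t\<close> and live in the first \<open>s\<close> rows, whose total is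
  \<open>s\<close>.\<close>

lemma unitary_zero_block_le:
  fixes G :: "complex mat"
  assumes G: "unitary m G" and t: "t \<le> m" and s: "s \<le> m"
    and 0: "\<And>i k. i < t \<Longrightarrow> s \<le> k \<Longrightarrow> k < m \<Longrightarrow> G $$ (k, i) = 0"
  shows "t \<le> s"
proof -
  let ?f = "\<lambda>k i. (cmod (G $$ (k, i)))\<^sup>2"
  have "real t = (\<Sum>i<t. \<Sum>k<m. ?f k i)" using complex_unitary_column_norm[OF G] t by simp
  also have "\<dots> = (\<Sum>i<t. \<Sum>k<s. ?f k i)"
    using 0 s by (intro sum.cong refl sum.mono_neutral_right) auto
  also have "\<dots> = (\<Sum>k<s. \<Sum>i<t. ?f k i)" by (rule sum.swap)
  also have "\<dots> \<le> (\<Sum>k<s. \<Sum>i<m. ?f k i)" using t by (intro sum_mono sum_mono2) auto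
  also have "\<dots> = real s" using complex_unitary_row_norm[OF G] s by simp
  finally show ?thesis by simp
qed

text \<open>\<open>ctr Q * (A * V)\<close> is computed twice: as the transition matrix
  \<open>G\<close> with columns scaled by the values of \<open>A\<close>, and through
  \<open>A = B * Z\<close> as a matrix whose rows from index \<open>s\<close> on vanish.\<close>

lemma dual_svd_le:
  assumes A: "A \<in> carrier_mat m n" and B: "B \<in> carrier_mat m k" and Z: "Z \<in> carrier_mat k n"
    and AB: "A = B * Z" and sA: "dual_svd A t \<mu> P V" and sB: "dual_svd B s \<nu> Q W"
  shows "t \<le> s"
proof -
  from sA[unfolded dual_svd_iff[OF A]] have t: "t \<le> m" "t \<le> n" and P: "unitary m P" and V: "unitary n V"
    and \<mu>: "\<And>i. i < t \<Longrightarrow> dual_pos (\<mu> i)" and AP: "A = P * rect_diag m n t \<mu> * ctr V" by auto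
  from sB[unfolded dual_svd_iff[OF B]] have s: "s \<le> m" "s \<le> k" and Q: "unitary m Q" and W: "unitary k W"
    and BQ: "B = Q * rect_diag m k s \<nu> * ctr W" by auto
  note c = unitaryD(1)[OF P] unitaryD(1)[OF V] unitaryD(1)[OF Q] unitaryD(1)[OF W]
  define G where "G = ctr Q * P"
  have G: "unitary m G" unfolding G_def by (intro unitary_mult unitary_ctr P Q)
  note gc = unitaryD(1)[OF G]
  define Y where "Y = ctr W * (Z * V)"
  have Y: "Y \<in> carrier_mat k n" using c Z by (auto simp: Y_def)
  have "A * V = P * rect_diag m n t \<mu>"
    unfolding AP by (rule unitary_cancel_right(2)[OF V mult_carrier_mat[OF c(1) rect_diag_carrier]])
  hence 1: "ctr Q * (A * V) = G * rect_diag m n t \<mu>"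
    unfolding G_def using c by (simp add: assoc_mult_mat[of _ m m _ m _ n])
  have ZV: "Z * V \<in> carrier_mat k n" using Z c by auto
  have "A * V = B * (Z * V)" unfolding AB by (rule assoc_mult_mat[OF B Z c(2)])
  also have "\<dots> = Q * rect_diag m k s \<nu> * Y"
    unfolding BQ Y_def using c ZV
    by (intro assoc_mult_mat[of _ m k _ k _ n]) auto
  also have "\<dots> = Q * (rect_diag m k s \<nu> * Y)"
    by (rule assoc_mult_mat[OF c(3) rect_diag_carrier Y])
  finally have "A * V = Q * (rect_diag m k s \<nu> * Y)" .
  hence 2: "ctr Q * (A * V) = rect_diag m k s \<nu> * Y"
    using unitary_cancel(1)[OF Q mult_carrier_mat[OF rect_diag_carrier Y]] by simp
  have "std_mat G $$ (l, i) = 0" if "i < t" "s \<le> l" "l < m" for i l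
  proof -
    have i: "i < n" "i < m" using that t by auto
    have "(G * rect_diag m n t \<mu>) $$ (l, i) = (\<Sum>j<m. G $$ (l, j) * rect_diag m n t \<mu> $$ (j, i))"
      using gc that i by (intro index_mult_mat_sum[of _ m m _ n]) auto
    also have "\<dots> = (\<Sum>j<m. if j = i then G $$ (l, i) * \<mu> i else 0)"
      using that i by (intro sum.cong) (auto simp: rect_diag_def)
    also have "\<dots> = G $$ (l, i) * \<mu> i" using i by simp
    finally have "G $$ (l, i) * \<mu> i = (rect_diag m k s \<nu> * Y) $$ (l, i)" using 1 2 by simp
    also have "\<dots> = 0"
      using Y that i by (subst index_mult_mat_sum[of _ m k _ n])
        (auto simp: rect_diag_def intro!: sum.neutral)
    finally have "G $$ (l, i) * \<mu> i = 0" .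
    moreover have "\<mu> i \<noteq> 0" using \<mu>[OF that(1)] by (simp add: dual_pos_def)
    \<comment> \<open>An infinitesimal \<open>\<mu> i\<close> is a zero divisor, so only the
      standard part of the entry is forced to vanish. This suffices, since \<open>std_mat G\<close>
      is still unitary.\<close>
    ultimately have "std_part (G $$ (l, i)) = 0" by (auto simp: dual_complex_eq_iff)
    thus ?thesis using gc that i by (simp add: std_mat_def)
  qed
  thus ?thesis by (rule unitary_zero_block_le[OF unitary_std_mat[OF G] t(1) s(1)])
qed

text \<open>Any two decompositions of \<open>A\<close> have equally many values:
  \<open>dual_svd_le\<close> applies in both directions, with the identity matrix as the factor
  \<open>Z\<close>.\<close>

lemma Rank_eqI:
  assumes A: "A \<in> carrier_mat m n" and svd: "dual_svd A t \<mu> P V"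
  shows "Rank A = t"
  unfolding Rank_def
proof (rule the_equality)
  have "A = A * 1\<^sub>m n" using A by simp
  note le = dual_svd_le[OF A A one_carrier_mat this]
  show "s = t" if "\<exists>\<mu> P V. dual_svd A s \<mu> P V" for s
    using that svd le by (metis order_antisym)
qed (use svd in blast)

lemma Rank_le_dim:
  assumes A: "A \<in> carrier_mat m n"
  shows "Rank A \<le> m"
  using dual_svd_exists[OF A] Rank_eqI[OF A] by (metis dual_svd_iff[OF A])

lemma Rank_mono:
  assumes A: "A \<in> carrier_mat m n" and B: "B \<in> carrier_mat m k" and Z: "Z \<in> carrier_mat k n"
    and AB: "A = B * Z"
  shows "Rank A \<le> Rank B"
proof -
  obtain t \<mu> P V where a: "dual_svd A t \<mu> P V" using dual_svd_exists[OF A] by blast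
  obtain s \<nu> Q W where b: "dual_svd B s \<nu> Q W" using dual_svd_exists[OF B] by blast
  show ?thesis
    using dual_svd_le[OF A B Z AB a b] Rank_eqI[OF A a] Rank_eqI[OF B b] by simp
qed

section \<open>Core inverses in block form\<close>

text \<open>Each column of \<open>A\<close> is the image of a unit vector, hence has a preimage
  under \<open>B\<close>; these preimages are the columns of \<open>Z\<close>.\<close>

lemma range_mat_subset_factor:
  assumes A: "A \<in> carrier_mat m n" and B: "B \<in> carrier_mat m k"
    and sub: "range_mat A \<subseteq> range_mat B"
  shows "\<exists>Z \<in> carrier_mat k n. A = B * Z"
proof -
  have "\<exists>x \<in> carrier_vec k. col A j = B *\<^sub>v x" if "j < n" for j
  proof -
    have "A *\<^sub>v unit_vec n j \<in> range_mat A" using A by (auto simp: range_mat_def)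
    hence "A *\<^sub>v unit_vec n j \<in> range_mat B" using sub by blast
    moreover have "A *\<^sub>v unit_vec n j = col A j" using A that by (intro eq_vecI) auto
    ultimately show ?thesis using B by (auto simp: range_mat_def)
  qed
  then obtain x where x: "\<And>j. j < n \<Longrightarrow> x j \<in> carrier_vec k \<and> col A j = B *\<^sub>v x j" by metis
  define Z where "Z = mat k n (\<lambda>(i, j). x j $ i)"
  have Z: "Z \<in> carrier_mat k n" by (simp add: Z_def)
  have "A = B * Z"
  proof (rule eq_matI)
    fix i j assume "i < dim_row (B * Z)" "j < dim_col (B * Z)"
    hence ij: "i < m" "j < n" using B by (auto simp: Z_def)
    have "col Z j = x j" using x[OF ij(2)] ij by (intro eq_vecI) (auto simp: Z_def)
    hence "(B * Z) $$ (i, j) = (B *\<^sub>v x j) $ i" using B Z ij by simp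
    also have "\<dots> = col A j $ i" using x[OF ij(2)] by simp
    finally show "A $$ (i, j) = (B * Z) $$ (i, j)" using A ij by simp
  qed (use A B Z in auto)
  thus ?thesis using Z by blast
qed

lemma pow_mat_2: "A \<in> carrier_mat n n \<Longrightarrow> A ^\<^sub>m 2 = A * A"
  by (simp add: numeral_2_eq_2)

text \<open>Turns the range condition into a matrix equation, which can be compared block by
  block.\<close>

lemma CM_factor:
  assumes "A \<in> CM n"
  shows "\<exists>Z \<in> carrier_mat n n. A = A * A * Z"
proof -
  have A: "A \<in> carrier_mat n n" and r: "range_mat (A ^\<^sub>m 2) = range_mat A"
    using assms unfolding CM_def by blast+
  have "A * A \<in> carrier_mat n n" using A by simp
  moreover have "range_mat A \<subseteq> range_mat (A * A)" using r unfolding pow_mat_2[OF A] by simp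
  ultimately show ?thesis by (rule range_mat_subset_factor[OF A])
qed

section \<open>Unitary congruence\<close>

text \<open>This map is injective on square matrices and respects products and \<open>ctr\<close>,
  so core inverses and the order can be computed on the middle factor.\<close>

definition ucong :: "dual_complex mat \<Rightarrow> dual_complex mat \<Rightarrow> dual_complex mat" where
  "ucong U M = U * M * ctr U"

lemma ucong_carrier:
  "unitary n U \<Longrightarrow> M \<in> carrier_mat n n \<Longrightarrow> ucong U M \<in> carrier_mat n n"
  using unitaryD(1)[of n U] by (auto simp: ucong_def)

lemma ucong_mult:
  assumes U: "unitary n U" and M: "M \<in> carrier_mat n n" "N \<in> carrier_mat n n"
  shows "ucong U M * ucong U N = ucong U (M * N)"
proof -
  note uc = unitaryD(1)[OF U]
  have "N * ctr U \<in> carrier_mat n n" using M uc by auto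
  note cancel = unitary_cancel(1)[OF U this]
  show ?thesis unfolding ucong_def using uc M cancel
    by (simp add: assoc_mult_mat[of _ n n _ n _ n] mult_carrier_mat[of _ n n])
qed

lemma ctr_ucong:
  assumes "unitary n U" "M \<in> carrier_mat n n"
  shows "ctr (ucong U M) = ucong U (ctr M)"
  unfolding ucong_def using unitaryD(1)[OF assms(1)] assms(2)
  by (simp add: ctr_mult[of _ n n _ n] assoc_mult_mat[of _ n n _ n _ n] mult_carrier_mat[of _ n n])

lemma ucong_ctr:
  assumes U: "unitary n U" and M: "M \<in> carrier_mat n n"
  shows "ucong U (ctr U * M * U) = M" "ctr U * ucong U M * U = M"
proof -
  note uc = unitaryD(1)[OF U]
  have MU: "M * U \<in> carrier_mat n n" "M * ctr U \<in> carrier_mat n n" using M uc by auto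
  show "ucong U (ctr U * M * U) = M"
    using uc M MU unitary_cancel(2)[OF U MU(1)] unitary_cancel_right(1)[OF U M]
    by (simp add: ucong_def assoc_mult_mat[of "ctr U" n n _ n _ n])
  show "ctr U * ucong U M * U = M"
    using uc M MU unitary_cancel(1)[OF U MU(2)] unitary_cancel_right(2)[OF U M]
    by (simp add: ucong_def assoc_mult_mat[of U n n _ n _ n])
qed

lemma ucong_inject:
  "unitary n U \<Longrightarrow> M \<in> carrier_mat n n \<Longrightarrow> N \<in> carrier_mat n n \<Longrightarrow>
    ucong U M = ucong U N \<longleftrightarrow> M = N"
  by (metis ucong_ctr(2))

section \<open>Splitting into blocks\<close>

lemma four_block_cases:
  assumes "M \<in> carrier_mat (r + m) (r + m)"
  obtains M1 M2 M3 M4 where "M1 \<in> carrier_mat r r" "M2 \<in> carrier_mat r m"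
    "M3 \<in> carrier_mat m r" "M4 \<in> carrier_mat m m" "M = four_block_mat M1 M2 M3 M4"
proof -
  obtain M1 M2 M3 M4 where s: "split_block M r r = (M1, M2, M3, M4)" by (metis prod_cases4)
  have "dim_row M = r + m" "dim_col M = r + m" using assms by auto
  from split_block[OF s this] show thesis by (rule that)
qed

lemma four_block_mat_inject:
  assumes "A \<in> carrier_mat r r" "B \<in> carrier_mat r m" "C \<in> carrier_mat m r" "D \<in> carrier_mat m m"
    and "A' \<in> carrier_mat r r" "B' \<in> carrier_mat r m" "C' \<in> carrier_mat m r" "D' \<in> carrier_mat m m"
  shows "four_block_mat A B C D = four_block_mat A' B' C' D' \<longleftrightarrow> A = A' \<and> B = B' \<and> C = C' \<and> D = D'"
proof
  assume eq: "four_block_mat A B C D = four_block_mat A' B' C' D'"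
  have e: "four_block_mat A B C D $$ (i, j) = four_block_mat A' B' C' D' $$ (i, j)" for i j
    by (simp add: eq)
  show "A = A' \<and> B = B' \<and> C = C' \<and> D = D'"
  proof (intro conjI)
    show "A = A'"
    proof (rule eq_matI)
      fix i j assume "i < dim_row A'" "j < dim_col A'"
      thus "A $$ (i, j) = A' $$ (i, j)" using e[of i j] assms by auto
    qed (use assms in auto)
    show "B = B'"
    proof (rule eq_matI)
      fix i j assume "i < dim_row B'" "j < dim_col B'"
      thus "B $$ (i, j) = B' $$ (i, j)" using e[of i "r + j"] assms by auto
    qed (use assms in auto)
    show "C = C'"
    proof (rule eq_matI)
      fix i j assume "i < dim_row C'" "j < dim_col C'"
      thus "C $$ (i, j) = C' $$ (i, j)" using e[of "r + i" j] assms by auto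
    qed (use assms in auto)
    show "D = D'"
    proof (rule eq_matI)
      fix i j assume "i < dim_row D'" "j < dim_col D'"
      thus "D $$ (i, j) = D' $$ (i, j)" using e[of "r + i" "r + j"] assms by auto
    qed (use assms in auto)
  qed
qed simp

section \<open>Block triangular matrices, their core inverses and the order\<close>

context
  fixes r m :: nat and U T S :: "dual_complex mat"
  assumes U: "unitary (r + m) U" and T: "T \<in> carrier_mat r r" and S: "S \<in> carrier_mat r m"
begin

abbreviation (input) "blk X Y V W \<equiv> four_block_mat X Y V (W :: dual_complex mat)"
abbreviation (input) "topblk X Y \<equiv> four_block_mat X Y (0\<^sub>m m r) (0\<^sub>m m m :: dual_complex mat)"

lemma blk_mult:
  assumes "X1 \<in> carrier_mat r r" "X2 \<in> carrier_mat r m" "X3 \<in> carrier_mat m r" "X4 \<in> carrier_mat m m"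
    "Y1 \<in> carrier_mat r r" "Y2 \<in> carrier_mat r m" "Y3 \<in> carrier_mat m r" "Y4 \<in> carrier_mat m m"
  shows "blk X1 X2 X3 X4 * blk Y1 Y2 Y3 Y4
    = blk (X1 * Y1 + X2 * Y3) (X1 * Y2 + X2 * Y4) (X3 * Y1 + X4 * Y3) (X3 * Y2 + X4 * Y4)"
  using assms by (intro mult_four_block_mat) auto

lemma block_CM_factor:
  assumes M: "M \<in> carrier_mat (r + m) (r + m)" and CM: "ucong U M \<in> CM (r + m)"
  obtains Z1 Z2 Z3 Z4 where "Z1 \<in> carrier_mat r r" "Z2 \<in> carrier_mat r m"
    "Z3 \<in> carrier_mat m r" "Z4 \<in> carrier_mat m m" "M = M * (M * blk Z1 Z2 Z3 Z4)"
proof -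
  obtain Z where Z: "Z \<in> carrier_mat (r + m) (r + m)" and eq: "ucong U M = ucong U M * ucong U M * Z"
    using CM_factor[OF CM] by blast
  define Y where "Y = ctr U * Z * U"
  have Y: "Y \<in> carrier_mat (r + m) (r + m)" using Z unitaryD(1)[OF U] by (auto simp: Y_def)
  have "ucong U M = ucong U (M * M * Y)"
    using eq ucong_ctr(1)[OF U Z] ucong_mult[OF U M M] ucong_mult[OF U _ Y, of "M * M"] M
    by (simp add: Y_def)
  hence "M = M * M * Y" using ucong_inject[OF U M, of "M * M * Y"] M Y by auto
  hence MY: "M = M * (M * Y)" using M Y by (simp add: assoc_mult_mat[of _ "r + m" "r + m" _ "r + m" _ "r + m"])
  from Y obtain Z1 Z2 Z3 Z4 where "Z1 \<in> carrier_mat r r" "Z2 \<in> carrier_mat r m"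
    "Z3 \<in> carrier_mat m r" "Z4 \<in> carrier_mat m m" "Y = blk Z1 Z2 Z3 Z4" by (rule four_block_cases)
  thus thesis using MY that by blast
qed

text \<open>The factorization from \<open>CM\<close> yields \<open>T = T * W1\<close> and
  \<open>S = T * W2\<close>. Substituted into the equation for \<open>R1\<close> and
  \<open>R2\<close>, this exhibits a right inverse of \<open>T\<close>, which is two-sided because
  \<open>T\<close> is square.\<close>

lemma CM_imp_invertible_block:
  assumes R: "R1 \<in> carrier_mat r r" "R2 \<in> carrier_mat m r" "T * R1 + S * R2 = 1\<^sub>m r"
    and CM: "ucong U (topblk T S) \<in> CM (r + m)"
  shows "\<exists>Ti \<in> carrier_mat r r. T * Ti = 1\<^sub>m r \<and> Ti * T = 1\<^sub>m r"
proof -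
  have F: "topblk T S \<in> carrier_mat (r + m) (r + m)" using T S by auto
  obtain Z1 Z2 Z3 Z4 where Z: "Z1 \<in> carrier_mat r r" "Z2 \<in> carrier_mat r m"
    "Z3 \<in> carrier_mat m r" "Z4 \<in> carrier_mat m m"
    and eq: "topblk T S = topblk T S * (topblk T S * blk Z1 Z2 Z3 Z4)"
    using block_CM_factor[OF F CM] .
  define W1 where "W1 = T * Z1 + S * Z3"
  define W2 where "W2 = T * Z2 + S * Z4"
  have W: "W1 \<in> carrier_mat r r" "W2 \<in> carrier_mat r m" using T S Z by (auto simp: W1_def W2_def)
  have "topblk T S * blk Z1 Z2 Z3 Z4 = topblk W1 W2"
    using T S Z by (simp add: blk_mult W1_def W2_def)
  hence "topblk T S = topblk (T * W1) (T * W2)"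
    using eq T S W by (simp add: blk_mult)
  hence TW: "T = T * W1" "S = T * W2"
    using T S W by (auto simp: four_block_mat_inject[of _ r _ m])
  let ?Ti = "W1 * R1 + W2 * R2"
  have Ti: "?Ti \<in> carrier_mat r r" using W R by auto
  have "T * ?Ti = T * W1 * R1 + T * W2 * R2"
    using T W R by (simp add: mult_add_distrib_mat[of _ r r _ r] assoc_mult_mat[of T r r _ r _ r]
      assoc_mult_mat[of T r r _ m _ r])
  also have "\<dots> = 1\<^sub>m r" using TW R by simp
  finally show ?thesis using right_inverse_imp_left_inverse[OF T Ti] Ti by blast
qed

context
  fixes Ti assumes Ti: "Ti \<in> carrier_mat r r" "T * Ti = 1\<^sub>m r" "Ti * T = 1\<^sub>m r"
begin

lemma cancel_T:
  "X \<in> carrier_mat r k \<Longrightarrow> T * (Ti * X) = X"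
  "X \<in> carrier_mat r k \<Longrightarrow> Ti * (T * X) = X"
  "X \<in> carrier_mat k r \<Longrightarrow> X * T * Ti = X"
  "X \<in> carrier_mat k r \<Longrightarrow> X * Ti * T = X"
  using T Ti by (simp_all add: assoc_mult_mat[of _ r r _ r _ k, symmetric] assoc_mult_mat[of _ k r _ r _ r])

text \<open>Uniqueness is read off the blocks of a solution \<open>N\<close>: the lower rows of
  \<open>?F * (N * N) = N\<close> are zero, \<open>?F * N * ?F = ?F\<close> gives
  \<open>T * N1 = 1\<^sub>m r\<close>, and self-adjointness of \<open>?F * N\<close> gives
  \<open>T * N2 = 0\<^sub>m r m\<close>.\<close>

lemma core_inverse_block:
  assumes A: "A = ucong U (topblk T S)"
  shows "core_inverse A = ucong U (topblk Ti (0\<^sub>m r m))"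
proof -
  let ?n = "r + m"
  let ?F = "topblk T S" and ?G = "topblk Ti (0\<^sub>m r m)"
  have F: "?F \<in> carrier_mat ?n ?n" and G: "?G \<in> carrier_mat ?n ?n" using T S Ti by auto
  have n: "dim_row A = ?n" using ucong_carrier[OF U F] A by auto
  \<comment> \<open>The defining equations pass through the congruence, both for checking the
    candidate and for analyzing an arbitrary solution.\<close>
  have trans: "ucong U N \<in> carrier_mat ?n ?n \<and> A * ucong U N * A = A \<and> A * ucong U N ^\<^sub>m 2 = ucong U N \<and>
      adj (A * ucong U N) = A * ucong U N \<longleftrightarrow>
      ?F * N * ?F = ?F \<and> ?F * (N * N) = N \<and> ctr (?F * N) = ?F * N"
    if N: "N \<in> carrier_mat ?n ?n" for N
  proof -
    have c: "?F * N \<in> carrier_mat ?n ?n" "N * N \<in> carrier_mat ?n ?n" "?F * N * ?F \<in> carrier_mat ?n ?n"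
      "?F * (N * N) \<in> carrier_mat ?n ?n" "ctr (?F * N) \<in> carrier_mat ?n ?n"
      using F N by (auto simp del: four_block_carrier_mat)
    show ?thesis
      unfolding A pow_mat_2[OF ucong_carrier[OF U N]] adj_eq_ctr
        ucong_mult[OF U F N] ucong_mult[OF U N N] ucong_mult[OF U c(1) F] ucong_mult[OF U F c(2)]
        ctr_ucong[OF U c(1)] ucong_inject[OF U c(3) F] ucong_inject[OF U c(4) N]
        ucong_inject[OF U c(5) c(1)]
      using ucong_carrier[OF U N] by blast
  qed
  show ?thesis unfolding core_inverse_def n
  proof (rule the_equality)
    have FG: "?F * ?G = topblk (1\<^sub>m r) (0\<^sub>m r m)"
      using T S Ti by (simp add: blk_mult)
    have "?F * ?G * ?F = ?F" unfolding FG using T S by (simp add: blk_mult)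
    moreover have "?F * (?G * ?G) = ?G"
    proof -
      have "?F * (?G * ?G) = ?F * ?G * ?G" by (rule assoc_mult_mat[OF F G G, symmetric])
      also have "\<dots> = ?G" unfolding FG using Ti by (simp add: blk_mult)
      finally show ?thesis .
    qed
    moreover have "ctr (?F * ?G) = ?F * ?G" unfolding FG by (simp add: ctr_four_block[of _ r r _ m _ m])
    ultimately show "ucong U ?G \<in> carrier_mat ?n ?n \<and> A * ucong U ?G * A = A \<and>
      A * ucong U ?G ^\<^sub>m 2 = ucong U ?G \<and> adj (A * ucong U ?G) = A * ucong U ?G"
      unfolding trans[OF G] by blast
  next
    fix X assume X: "X \<in> carrier_mat ?n ?n \<and> A * X * A = A \<and> A * X ^\<^sub>m 2 = X \<and> adj (A * X) = A * X"
    define N where "N = ctr U * X * U"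
    have N: "N \<in> carrier_mat ?n ?n" using X unitaryD(1)[OF U] by (auto simp: N_def)
    have XN: "X = ucong U N" unfolding N_def using ucong_ctr(1)[OF U] X by simp
    have e: "?F * N * ?F = ?F" "?F * (N * N) = N" "ctr (?F * N) = ?F * N"
      using X trans[OF N] unfolding XN by auto
    from N obtain N1 N2 N3 N4 where c: "N1 \<in> carrier_mat r r" "N2 \<in> carrier_mat r m"
      "N3 \<in> carrier_mat m r" "N4 \<in> carrier_mat m m" and Nb: "N = blk N1 N2 N3 N4"
      by (rule four_block_cases)
    have "N * N \<in> carrier_mat ?n ?n" using N by simp
    then obtain Y1 Y2 Y3 Y4 where y: "Y1 \<in> carrier_mat r r" "Y2 \<in> carrier_mat r m"
      "Y3 \<in> carrier_mat m r" "Y4 \<in> carrier_mat m m" and Y: "N * N = blk Y1 Y2 Y3 Y4"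
      by (rule four_block_cases)
    have "topblk (T * Y1 + S * Y3) (T * Y2 + S * Y4) = blk N1 N2 N3 N4"
      using e(2)[unfolded Y] T S y unfolding Nb by (simp add: blk_mult)
    hence N34: "N3 = 0\<^sub>m m r" "N4 = 0\<^sub>m m m"
      using T S y c by (subst (asm) four_block_mat_inject[of _ r _ m], auto)+
    define V1 where "V1 = T * N1"
    define V2 where "V2 = T * N2"
    have V: "V1 \<in> carrier_mat r r" "V2 \<in> carrier_mat r m" using T c by (auto simp: V1_def V2_def)
    have VT: "V1 * T \<in> carrier_mat r r" "V1 * S \<in> carrier_mat r m" using T S V by auto
    have FN: "?F * N = topblk V1 V2"
      using T S c unfolding Nb N34 V1_def V2_def by (simp add: blk_mult)
    have "topblk (V1 * T) (V1 * S) = ?F"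
      using e(1) T S V VT unfolding FN by (simp add: blk_mult)
    hence "V1 * T = T" using T S VT by (subst (asm) four_block_mat_inject[of _ r _ m]) auto
    hence "V1 = 1\<^sub>m r" using cancel_T(3)[OF V(1)] Ti by simp
    hence N1: "N1 = Ti" using cancel_T(2)[OF c(1)] Ti unfolding V1_def by simp
    have "blk (ctr V1) (0\<^sub>m r m) (ctr V2) (0\<^sub>m m m) = topblk V1 V2"
      using e(3) V unfolding FN by (simp add: ctr_four_block[of _ r r _ m _ m])
    hence "T * N2 = 0\<^sub>m r m"
      using V unfolding V2_def[symmetric] by (subst (asm) four_block_mat_inject[of _ r _ m]) auto
    hence N2: "N2 = 0\<^sub>m r m" using cancel_T(2)[OF c(2)] Ti by simp
    show "X = ucong U ?G" unfolding XN Nb N1 N2 N34 ..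
  qed
qed

text \<open>Multiplying \<open>N\<close> by \<open>?G\<close> from the left determines its upper
  blocks, and from the right its lower left block, as \<open>Ti\<close> can be cancelled. The lower
  right block stays free and becomes \<open>P\<close>.\<close>

lemma d_core_le_block:
  assumes A: "A = ucong U (topblk T S)" and CM: "A \<in> CM (r + m)" "B \<in> CM (r + m)"
  shows "d_core_le A B \<longleftrightarrow> (\<exists>P \<in> carrier_mat m m. B = ucong U (blk T S (0\<^sub>m m r) P))"
proof -
  let ?n = "r + m"
  let ?F = "topblk T S" and ?G = "topblk Ti (0\<^sub>m r m)"
  have F: "?F \<in> carrier_mat ?n ?n" and G: "?G \<in> carrier_mat ?n ?n" using T S Ti by auto
  have n: "dim_row A = ?n" using ucong_carrier[OF U F] A by auto
  have Bc: "B \<in> carrier_mat ?n ?n" using CM by (simp add: CM_def)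
  define N where "N = ctr U * B * U"
  have N: "N \<in> carrier_mat ?n ?n" using Bc unitaryD(1)[OF U] by (auto simp: N_def)
  have BN: "B = ucong U N" unfolding N_def using ucong_ctr(1)[OF U] Bc by simp
  from N obtain N1 N2 N3 N4 where c: "N1 \<in> carrier_mat r r" "N2 \<in> carrier_mat r m"
    "N3 \<in> carrier_mat m r" "N4 \<in> carrier_mat m m" and Nb: "N = blk N1 N2 N3 N4"
    by (rule four_block_cases)
  have TN: "Ti * N1 \<in> carrier_mat r r" "Ti * N2 \<in> carrier_mat r m" "Ti * S \<in> carrier_mat r m"
    "N1 * Ti \<in> carrier_mat r r" "N3 * Ti \<in> carrier_mat m r" using Ti c S by auto
  have p: "?G * ?F \<in> carrier_mat ?n ?n" "?G * N \<in> carrier_mat ?n ?n" "?F * ?G \<in> carrier_mat ?n ?n"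
    "N * ?G \<in> carrier_mat ?n ?n" using F G N by (auto simp del: four_block_carrier_mat)
  have "d_core_le A B \<longleftrightarrow> ?G * ?F = ?G * N \<and> ?F * ?G = N * ?G"
    unfolding d_core_le_def n core_inverse_block[OF A]
    using CM unfolding A BN ucong_mult[OF U F G] ucong_mult[OF U G F] ucong_mult[OF U G N]
      ucong_mult[OF U N G] ucong_inject[OF U p(1,2)] ucong_inject[OF U p(3,4)] by blast
  also have "\<dots> \<longleftrightarrow> topblk (1\<^sub>m r) (Ti * S) = topblk (Ti * N1) (Ti * N2) \<and>
      topblk (1\<^sub>m r) (0\<^sub>m r m) = blk (N1 * Ti) (0\<^sub>m r m) (N3 * Ti) (0\<^sub>m m m)"
    unfolding Nb using T S Ti c by (simp add: blk_mult)
  also have "\<dots> \<longleftrightarrow> 1\<^sub>m r = Ti * N1 \<and> Ti * S = Ti * N2 \<and> 1\<^sub>m r = N1 * Ti \<and> 0\<^sub>m m r = N3 * Ti"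
    using TN by (simp add: four_block_mat_inject[of _ r _ m])
  also have "\<dots> \<longleftrightarrow> N1 = T \<and> N2 = S \<and> N3 = 0\<^sub>m m r"
  proof safe
    assume 1: "1\<^sub>m r = Ti * N1" and 2: "Ti * S = Ti * N2" and 3: "0\<^sub>m m r = N3 * Ti"
    show "N1 = T" using cancel_T(1)[OF c(1)] T unfolding 1[symmetric] by simp
    show "N2 = S" using cancel_T(1)[OF c(2)] cancel_T(1)[OF S] 2 by simp
    show "N3 = 0\<^sub>m m r" using cancel_T(4)[OF c(3)] T unfolding 3[symmetric] by simp
  qed (use Ti in auto)
  also have "\<dots> \<longleftrightarrow> (\<exists>P \<in> carrier_mat m m. N = blk T S (0\<^sub>m m r) P)"
    unfolding Nb using T S c by (auto simp: four_block_mat_inject[of _ r _ m])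
  also have "\<dots> \<longleftrightarrow> (\<exists>P \<in> carrier_mat m m. B = ucong U (blk T S (0\<^sub>m m r) P))"
    unfolding BN using ucong_inject[OF U N] T S by (intro bex_cong refl) simp
  finally show ?thesis .
qed

end

text \<open>Because of the zero block below \<open>T\<close>, the lower right block of the
  factorization reads \<open>P = P * (P * Z4)\<close>. Thus \<open>P\<close> and
  \<open>P * P\<close> are right multiples of each other, and \<open>Rank_mono\<close> applies both
  ways.\<close>

lemma CM_block_Rank:
  assumes P: "P \<in> carrier_mat m m" and CM: "ucong U (blk T S (0\<^sub>m m r) P) \<in> CM (r + m)"
  shows "Rank (P ^\<^sub>m 2) = Rank P"
proof -
  have M: "blk T S (0\<^sub>m m r) P \<in> carrier_mat (r + m) (r + m)" using T S P by auto
  obtain Z1 Z2 Z3 Z4 where Z: "Z1 \<in> carrier_mat r r" "Z2 \<in> carrier_mat r m"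
    "Z3 \<in> carrier_mat m r" "Z4 \<in> carrier_mat m m"
    and eq: "blk T S (0\<^sub>m m r) P = blk T S (0\<^sub>m m r) P * (blk T S (0\<^sub>m m r) P * blk Z1 Z2 Z3 Z4)"
    using block_CM_factor[OF M CM] .
  define W1 where "W1 = T * Z1 + S * Z3"
  define W2 where "W2 = T * Z2 + S * Z4"
  have W: "W1 \<in> carrier_mat r r" "W2 \<in> carrier_mat r m" using T S Z by (auto simp: W1_def W2_def)
  have PZ: "P * Z3 \<in> carrier_mat m r" "P * Z4 \<in> carrier_mat m m" using P Z by auto
  have "blk T S (0\<^sub>m m r) P * blk Z1 Z2 Z3 Z4 = blk W1 W2 (P * Z3) (P * Z4)"
    using T S P Z by (simp add: blk_mult W1_def W2_def)
  hence "blk T S (0\<^sub>m m r) P =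
      blk (T * W1 + S * (P * Z3)) (T * W2 + S * (P * Z4)) (P * (P * Z3)) (P * (P * Z4))"
    using eq T S P W PZ by (simp add: blk_mult)
  hence "P = P * (P * Z4)"
    using T S P W PZ by (subst (asm) four_block_mat_inject[of _ r _ m]) auto
  hence "P = P * P * Z4" using P Z by (simp add: assoc_mult_mat[of _ m m _ m _ m])
  hence "Rank P \<le> Rank (P * P)" using P Z by (intro Rank_mono[of _ m m _ m Z4]) auto
  moreover have "Rank (P * P) \<le> Rank P" using P by (intro Rank_mono[of _ m m _ m P]) auto
  ultimately show ?thesis using P by (simp add: pow_mat_2)
qed

end

lemma appreciable_diag_inverse:
  assumes "appreciable_sing_vals r \<mu>"
  shows "\<exists>\<nu>. mat_diag r \<mu> * mat_diag r \<nu> = 1\<^sub>m r"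
proof -
  have "\<mu> i dvd 1" if "i < r" for i
    using assms that by (intro dual_complex_unit) (auto simp: appreciable_sing_vals_def appreciable_def)
  hence "\<forall>i. \<exists>y. i < r \<longrightarrow> \<mu> i * y = 1" by (metis dvdE)
  then obtain \<nu> where "\<And>i. i < r \<Longrightarrow> \<mu> i * \<nu> i = 1" by metis
  hence "mat_diag r \<mu> * mat_diag r \<nu> = 1\<^sub>m r"
    unfolding mat_diag_diag by (intro eq_matI) (auto simp: mat_diag_def)
  thus ?thesis by blast
qed

text \<open>The stacked blocks \<open>ctr K\<close> and \<open>ctr L\<close> form a right inverse of
  the block row \<open>[K L]\<close>; multiplied by the inverse \<open>?E\<close> of the diagonal
  factor, they provide \<open>R1\<close> and \<open>R2\<close> for
  \<open>CM_imp_invertible_block\<close>.\<close>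

lemma core_form_invertible:
  assumes U: "unitary (r + m) U" and K: "K \<in> carrier_mat r r" and L: "L \<in> carrier_mat r m"
    and KL: "K * adj K + L * adj L = 1\<^sub>m r" and \<mu>: "appreciable_sing_vals r \<mu>"
    and CM: "ucong U (four_block_mat (mat_diag r \<mu> * K) (mat_diag r \<mu> * L) (0\<^sub>m m r) (0\<^sub>m m m)) \<in> CM (r + m)"
  shows "\<exists>Ti \<in> carrier_mat r r. mat_diag r \<mu> * K * Ti = 1\<^sub>m r \<and> Ti * (mat_diag r \<mu> * K) = 1\<^sub>m r"
proof -
  obtain \<nu> where \<nu>: "mat_diag r \<mu> * mat_diag r \<nu> = 1\<^sub>m r" using appreciable_diag_inverse[OF \<mu>] ..
  let ?D = "mat_diag r \<mu>" and ?E = "mat_diag r \<nu>"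
  have T: "?D * K \<in> carrier_mat r r" "?D * L \<in> carrier_mat r m"
    using K L mat_diag_dim by (metis mult_carrier_mat)+
  have R: "ctr K * ?E \<in> carrier_mat r r" "ctr L * ?E \<in> carrier_mat m r"
    using K L mat_diag_dim by (metis ctr_carrier mult_carrier_mat)+
  have c: "K * ctr K \<in> carrier_mat r r" "L * ctr L \<in> carrier_mat r r" using K L by auto
  have "?D * K * (ctr K * ?E) + ?D * L * (ctr L * ?E) = ?D * (K * ctr K) * ?E + ?D * (L * ctr L) * ?E"
    using K L R by (simp add: assoc_mult_mat[of _ r r _ r _ r] assoc_mult_mat[of _ r r _ m _ r]
      assoc_mult_mat[of _ r m _ r _ r] mult_carrier_mat[of _ r r])
  also have "\<dots> = ?D * (K * ctr K + L * ctr L) * ?E"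
    using c by (simp add: mult_add_distrib_mat[of _ r r _ r] add_mult_distrib_mat[of _ r r _ _ r]
      mult_carrier_mat[of _ r r])
  also have "\<dots> = 1\<^sub>m r" using KL \<nu> mat_diag_dim[of r \<mu>] by (simp only: adj_eq_ctr right_mult_one_mat)
  finally show ?thesis by (rule CM_imp_invertible_block[OF U T R _ CM])
qed

theorem theorem4p19:
  fixes A B U K L :: "dual_complex mat"
    and \<mu> :: "nat \<Rightarrow> dual_complex"
    and n r :: nat
  assumes "A \<in> CM n" and "B \<in> CM n"
    and "r = Rank A"
    and "U \<in> unitary_mats n"
    and "K \<in> carrier_mat r r" and "L \<in> carrier_mat r (n - r)"
    and "K * adj K + L * adj L = 1\<^sub>m r"
    and "appreciable_sing_vals r \<mu>"
    and "A = U * four_block_mat (mat_diag r \<mu> * K) (mat_diag r \<mu> * L)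
                                (0\<^sub>m (n - r) r) (0\<^sub>m (n - r) (n - r)) * adj U"
  shows "d_core_le A B \<longleftrightarrow>
    (\<exists>U \<in> unitary_mats n. \<exists>K \<in> carrier_mat r r. \<exists>L \<in> carrier_mat r (n - r).
     \<exists>P \<in> carrier_mat (n - r) (n - r). \<exists>\<mu>.
       A = U * four_block_mat (mat_diag r \<mu> * K) (mat_diag r \<mu> * L)
                              (0\<^sub>m (n - r) r) (0\<^sub>m (n - r) (n - r)) * adj U \<and>
       B = U * four_block_mat (mat_diag r \<mu> * K) (mat_diag r \<mu> * L)
                              (0\<^sub>m (n - r) r) P * adj U \<and>
       K * adj K + L * adj L = 1\<^sub>m r \<and>
       Rank (P ^\<^sub>m 2) = Rank P \<and>
       appreciable_sing_vals r \<mu>)"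
proof -
  have "A \<in> carrier_mat n n" using assms(1) by (simp add: CM_def)
  \<comment> \<open>Ensures that the natural-number difference \<open>n - r\<close> is a true
    complement, \<open>n = r + m\<close>.\<close>
  hence "r \<le> n" using Rank_le_dim assms(3) by blast
  define m where "m = n - r"
  have n: "n = r + m" using \<open>r \<le> n\<close> by (simp add: m_def)
  note CM = assms(1,2)[unfolded n]
  \<comment> \<open>Stated for arbitrary \<open>U\<close>, \<open>K\<close>, \<open>L\<close> and
    \<open>\<mu>\<close>: the forward direction uses the given decomposition of \<open>A\<close>,
    the backward one the decomposition supplied by the existential.\<close>
  have le_iff: "d_core_le A B \<longleftrightarrow> (\<exists>P \<in> carrier_mat m m. B = ucong U (four_block_mat
      (mat_diag r \<mu> * K) (mat_diag r \<mu> * L) (0\<^sub>m m r) P))"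
    and carrier: "mat_diag r \<mu> * K \<in> carrier_mat r r" "mat_diag r \<mu> * L \<in> carrier_mat r m"
    if U: "unitary (r + m) U" and K: "K \<in> carrier_mat r r" and L: "L \<in> carrier_mat r m"
      and KL: "K * adj K + L * adj L = 1\<^sub>m r" and \<mu>: "appreciable_sing_vals r \<mu>"
      and A: "A = ucong U (four_block_mat (mat_diag r \<mu> * K) (mat_diag r \<mu> * L)
        (0\<^sub>m m r) (0\<^sub>m m m))" for U K L \<mu>
  proof -
    show c: "mat_diag r \<mu> * K \<in> carrier_mat r r" "mat_diag r \<mu> * L \<in> carrier_mat r m"
      using K L mat_diag_dim by (metis mult_carrier_mat)+
    obtain Ti where Ti: "Ti \<in> carrier_mat r r" "mat_diag r \<mu> * K * Ti = 1\<^sub>m r"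
      "Ti * (mat_diag r \<mu> * K) = 1\<^sub>m r"
      using core_form_invertible[OF U K L KL \<mu>] CM(1) A by blast
    show "d_core_le A B \<longleftrightarrow> (\<exists>P \<in> carrier_mat m m. B = ucong U (four_block_mat
        (mat_diag r \<mu> * K) (mat_diag r \<mu> * L) (0\<^sub>m m r) P))"
      by (rule d_core_le_block[OF U c Ti A CM])
  qed
  show ?thesis
  proof
    assume le: "d_core_le A B"
    have args: "unitary (r + m) U" "K \<in> carrier_mat r r" "L \<in> carrier_mat r m"
      "K * adj K + L * adj L = 1\<^sub>m r" "appreciable_sing_vals r \<mu>"
      "A = ucong U (four_block_mat (mat_diag r \<mu> * K) (mat_diag r \<mu> * L) (0\<^sub>m m r) (0\<^sub>m m m))"
      using assms(4-9) n unfolding unitary_mats_iff ucong_def m_def adj_eq_ctr by simp_all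
    from le obtain P where P: "P \<in> carrier_mat m m"
      and B: "B = ucong U (four_block_mat (mat_diag r \<mu> * K) (mat_diag r \<mu> * L) (0\<^sub>m m r) P)"
      unfolding le_iff[OF args] by blast
    have "Rank (P ^\<^sub>m 2) = Rank P"
      using CM_block_Rank[OF args(1) carrier[OF args] P] CM(2) B by simp
    thus "\<exists>U \<in> unitary_mats n. \<exists>K \<in> carrier_mat r r. \<exists>L \<in> carrier_mat r (n - r).
     \<exists>P \<in> carrier_mat (n - r) (n - r). \<exists>\<mu>.
       A = U * four_block_mat (mat_diag r \<mu> * K) (mat_diag r \<mu> * L)
                              (0\<^sub>m (n - r) r) (0\<^sub>m (n - r) (n - r)) * adj U \<and>
       B = U * four_block_mat (mat_diag r \<mu> * K) (mat_diag r \<mu> * L)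
                              (0\<^sub>m (n - r) r) P * adj U \<and>
       K * adj K + L * adj L = 1\<^sub>m r \<and>
       Rank (P ^\<^sub>m 2) = Rank P \<and>
       appreciable_sing_vals r \<mu>"
      using assms(4-9) P B unfolding ucong_def adj_eq_ctr[symmetric] m_def by blast
  next
    assume "\<exists>U \<in> unitary_mats n. \<exists>K \<in> carrier_mat r r. \<exists>L \<in> carrier_mat r (n - r).
     \<exists>P \<in> carrier_mat (n - r) (n - r). \<exists>\<mu>.
       A = U * four_block_mat (mat_diag r \<mu> * K) (mat_diag r \<mu> * L)
                              (0\<^sub>m (n - r) r) (0\<^sub>m (n - r) (n - r)) * adj U \<and>
       B = U * four_block_mat (mat_diag r \<mu> * K) (mat_diag r \<mu> * L)
                              (0\<^sub>m (n - r) r) P * adj U \<and>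
       K * adj K + L * adj L = 1\<^sub>m r \<and>
       Rank (P ^\<^sub>m 2) = Rank P \<and>
       appreciable_sing_vals r \<mu>"
    then obtain U K L P \<mu> where U: "U \<in> unitary_mats n" and K: "K \<in> carrier_mat r r"
      and L: "L \<in> carrier_mat r m" and P: "P \<in> carrier_mat m m"
      and A: "A = U * four_block_mat (mat_diag r \<mu> * K) (mat_diag r \<mu> * L) (0\<^sub>m m r) (0\<^sub>m m m) * adj U"
      and B: "B = U * four_block_mat (mat_diag r \<mu> * K) (mat_diag r \<mu> * L) (0\<^sub>m m r) P * adj U"
      and KL: "K * adj K + L * adj L = 1\<^sub>m r" and \<mu>: "appreciable_sing_vals r \<mu>"
      unfolding m_def by blast
    have U': "unitary (r + m) U" using U n by (simp add: unitary_mats_iff)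
    show "d_core_le A B"
      unfolding le_iff[OF U' K L KL \<mu> A[unfolded adj_eq_ctr, folded ucong_def]]
      using P B by (auto simp: ucong_def adj_eq_ctr)
  qed
qed

end
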